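(* Let $M$ be any matroid of rank $r$ on a nonempty finite set $E$ with $n$ elements. Then $$\omega^\circ(M)=\sum_{S_\bullet}(-1)^{k-1}\,\#\{\text{Ferroni paths weakly above all of } p_M(S_1),\dots,p_M(S_{k-1})\},$$ the sum over all chains $S_\bullet=(\emptyset=S_0\subsetneq S_1\subsetneq\dots\subsetneq S_k=E)$ of subsets of $E$, and also $$\omega^\circ(M)=\sum_{F_\bullet}(-1)^{k-1}\,\#\{\text{Ferroni paths weakly above all of } p_M(F_1),\dots,p_M(F_{k-1})\},$$ the sum over all chains $F_\bullet=(F_0\subsetneq F_1\subsetneq\dots\subsetneq F_k)$ of flats of $M$ that include the minimum flat $F_0=\operatorname{cl}_M(\emptyset)$ and the maximum flat $F_k=E$.
   Context: **Ferroni paths.** For $S\subseteq E$, $p_M(S)=(|S|-\operatorname{rank}_M(S),\operatorname{rank}_M(S))\in\mathbb Z^2$. A Ferroni path here is a lattice path from $(\tfrac12,\tfrac12)$ to $(n-r-\tfrac12,r-\tfrac12)$ with steps $(1,1)$ or $(1,0)$; thus a sequence of $n-r-1$ steps of which exactly $r-1$ are $(1,1)$ (there are none if this is impossible). It lies weakly above an integer point $(a,b)$ if it does not pass strictly below it (passing through is allowed); explicitly, if at least $b$ of its first $\min(a,n-r-1)$ steps are $(1,1)$. **$g$ and $\omega$.** Let $c(M)$ be the number of connected components of $M$. Speyer's $g$-polynomial $g_M(t)\in\mathbb Z[t]$ is given as follows (in the form of Berget–Eur–Spink–Tseng, equivalent to the original $K$-theoretic definition). If $E=\emptyset$, $g_M=1$.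 If $M$ has a loop or a coloop, $g_M=0$. Otherwise, for each total ordering $w=(w_1,\dots,w_n)$ of $E$, let $B_w$ be the basis with $w_k\in B_w$ iff $\operatorname{rank}\{w_1,\dots,w_k\}>\operatorname{rank}\{w_1,\dots,w_{k-1}\}$. In $\mathbb Z[z_e:e\in E]$, let $x^w$ be the list of the $z_b$, $b\in B_w$; let $y^w$ be the list of the $-z_c$, $c\in E\setminus B_w$; let $\alpha^w=-z_{w_n}$. For a family $f=(f_w)_w$ put $\deg f=\sum_w f_w/\prod_{i=1}^{n-1}(z_{w_i}-z_{w_{i+1}})$. With $\boldsymbol e_k$ the $k$-th elementary symmetric polynomial, $$g_M(t)=(-1)^{c(M)}\sum_{i=1}^{r}(-t)^i\sum_{j=0}^{i-1}\deg\big(\alpha^j\,\boldsymbol e_{i-j-1}(-y)\,\boldsymbol e_{r-i}(x)\,\boldsymbol e_{n-r}(y)\big).$$ $\omega(M)$ is the coefficient of $t^r$ in $g_M(t)$, and $\omega^\circ(M)=(-1)^{c(M)-1}\omega(M)$.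
   Formalization: The formula over chains of flats is stated only for M without loops; with loops it is false, e.g. for a coloop plus a loop (n=2, r=1) the sum over flats is 1 while ω°(M)=0. The formula over chains of subsets is stated for every matroid. *)

theory Defs
  imports
    "HOL-Library.Poly_Mapping"
    "HOL-Library.Product_Plus"
    "HOL-Computational_Algebra.Polynomial"
    "HOL-Computational_Algebra.Fraction_Field"
    "HOL-Combinatorics.Multiset_Permutations"
begin

section \<open>The polynomial ring over the integers in variables indexed by a type\<close>

text \<open>
  \<^theory>\<open>HOL-Library.Poly_Mapping\<close> already provides these rings, but as integral domains only for
  linearly ordered variables.  The copy below is an integral domain for an arbitrary type of
  variables, so that its fraction field can be formed.
\<close>

lemma poly_mapping_mult_neq_0:
  fixes p q :: "('a \<Rightarrow>\<^sub>0 nat) \<Rightarrow>\<^sub>0 int"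
  assumes "p \<noteq> 0" and "q \<noteq> 0"
  shows "p * q \<noteq> 0"
proof -
  define V where "V = (\<Union>m\<in>Poly_Mapping.keys p \<union> Poly_Mapping.keys q. Poly_Mapping.keys m)"
  have finV: "finite V"
    unfolding V_def by (intro finite_UN_I finite_UnI Poly_Mapping.finite_keys)
  then obtain h :: "'a \<Rightarrow> nat" where h: "inj_on h V"
    using finite_imp_inj_to_nat_seg by blast
  define \<Psi> :: "('a \<Rightarrow>\<^sub>0 nat) \<Rightarrow> (nat \<Rightarrow>\<^sub>0 nat)"
    where "\<Psi> = (\<lambda>m. \<Sum>x\<in>V. Poly_Mapping.single (h x) (Poly_Mapping.lookup m x))"
  have \<Psi>_add: "\<Psi> (m + m') = \<Psi> m + \<Psi> m'" for m m'
    by (simp add: \<Psi>_def lookup_add single_add sum.distrib)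
  have \<Psi>_lookup: "Poly_Mapping.lookup (\<Psi> m) (h x) = Poly_Mapping.lookup m x" if "x \<in> V" for m x
  proof -
    have "Poly_Mapping.lookup (\<Psi> m) (h x) = 
        (\<Sum>y\<in>V. if y = x then Poly_Mapping.lookup m y else 0)"
      unfolding \<Psi>_def lookup_sum
      by (rule sum.cong) (use h that in \<open>auto simp: lookup_single when_def inj_on_def\<close>)
    then show ?thesis
      using finV that by simp
  qed
  have \<Psi>_inj: "m = m'"
    if "\<Psi> m = \<Psi> m'" "m \<in>Poly_Mapping.keys p \<union> Poly_Mapping.keys q"
      "m' \<in>Poly_Mapping.keys p \<union> Poly_Mapping.keys q" for m m'
  proof (rule poly_mapping_eqI)
    fix x
    show "Poly_Mapping.lookup m x = Poly_Mapping.lookup m' x"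
    proof (cases "x \<in> V")
      case True
      then show ?thesis
        using \<Psi>_lookup that(1) by metis
    next
      case False
      then have "x \<notin> Poly_Mapping.keys m" "x \<notin> Poly_Mapping.keys m'"
        using that(2,3) by (auto simp: V_def)
      then show ?thesis
        by (simp add: in_keys_iff)
    qed
  qed
  have max: "\<exists>m\<in>Poly_Mapping.keys f. \<forall>a\<in>Poly_Mapping.keys f. \<Psi> a \<le> \<Psi> m" if "f \<noteq> 0"
    for f :: "('a \<Rightarrow>\<^sub>0 nat) \<Rightarrow>\<^sub>0 int"
  proof -
    have "Max (\<Psi> ` Poly_Mapping.keys f) \<in> \<Psi> ` Poly_Mapping.keys f"
      using that by (intro Max_in) auto
    then obtain m where "m \<in>Poly_Mapping.keys f" "\<Psi> m = Max (\<Psi> ` Poly_Mapping.keys f)"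
      by auto
    then show ?thesis
      by (intro bexI[of _ m]) auto
  qed
  obtain m where m: "m \<in>Poly_Mapping.keys p" "\<And>a. a \<in>Poly_Mapping.keys p \<Longrightarrow> \<Psi> a \<le> \<Psi> m"
    using max[OF assms(1)] by blast
  obtain m' where m': "m' \<in>Poly_Mapping.keys q" "\<And>a. a \<in>Poly_Mapping.keys q \<Longrightarrow> \<Psi> a \<le> \<Psi> m'"
    using max[OF assms(2)] by blast
  have uniq: "a = m \<and> b = m'" if "a \<in>Poly_Mapping.keys p" "b \<in>Poly_Mapping.keys q" "m + m' = a + b"
    for a b
  proof -
    have "\<Psi> m + \<Psi> m' = \<Psi> a + \<Psi> b"
      using that(3) by (metis \<Psi>_add)
    moreover have "\<Psi> a \<le> \<Psi> m" "\<Psi> b \<le> \<Psi> m'"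
      using m m' that by auto
    ultimately have "\<Psi> a = \<Psi> m" "\<Psi> b = \<Psi> m'"
      by (metis add_le_less_mono add_less_le_mono less_irrefl order.not_eq_order_implies_strict)+
    then show ?thesis
      using \<Psi>_inj m(1) m'(1) that by blast
  qed
  have "Poly_Mapping.lookup (p * q) (m + m') =
      (\<Sum>(a, b). Poly_Mapping.lookup p a * Poly_Mapping.lookup q b when m + m' = a + b)"
    by (simp add: times_poly_mapping.rep_eq prod_fun_unfold_prod)
  also have "\<dots> = (\<Sum>ab. (case ab of (a, b) \<Rightarrow> Poly_Mapping.lookup p a * Poly_Mapping.lookup q b)
      when (m, m') = ab)"
  proof (rule Sum_any.cong)
    fix ab :: "('a \<Rightarrow>\<^sub>0 nat) \<times> ('a \<Rightarrow>\<^sub>0 nat)"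
    obtain a b where ab: "ab = (a, b)"
      by (cases ab)
    show "(case ab of (a, b) \<Rightarrow> Poly_Mapping.lookup p a * Poly_Mapping.lookup q b when m + m' = a + b)
        = ((case ab of (a, b) \<Rightarrow> Poly_Mapping.lookup p a * Poly_Mapping.lookup q b) when (m, m') = ab)"
      using uniq[of a b] by (auto simp: ab when_def in_keys_iff)
  qed
  also have "\<dots> = Poly_Mapping.lookup p m * Poly_Mapping.lookup q m'"
    by simp
  also have "\<dots> \<noteq> 0"
    using m(1) m'(1) by (simp add: in_keys_iff)
  finally show ?thesis
    by auto
qed

typedef 'a zpoly = "UNIV :: (('a \<Rightarrow>\<^sub>0 nat) \<Rightarrow>\<^sub>0 int) set"
  morphisms mapping_of_zpoly zpoly_of_mapping ..

setup_lifting type_definition_zpoly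

instantiation zpoly :: (type) idom
begin

lift_definition zero_zpoly :: "'a zpoly" is 0 .
lift_definition one_zpoly :: "'a zpoly" is 1 .
lift_definition plus_zpoly :: "'a zpoly \<Rightarrow> 'a zpoly \<Rightarrow> 'a zpoly" is "(+)" .
lift_definition minus_zpoly :: "'a zpoly \<Rightarrow> 'a zpoly \<Rightarrow> 'a zpoly" is "(-)" .
lift_definition uminus_zpoly :: "'a zpoly \<Rightarrow> 'a zpoly" is uminus .
lift_definition times_zpoly :: "'a zpoly \<Rightarrow> 'a zpoly \<Rightarrow> 'a zpoly" is "(*)" .

instance
proof
  fix a b :: "'a zpoly"
  assume "a \<noteq> 0" "b \<noteq> 0"
  then show "a * b \<noteq> 0"
    by transfer (rule poly_mapping_mult_neq_0)
qed (transfer, simp add: algebra_simps)+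

end

lift_definition Var :: "'a \<Rightarrow> 'a zpoly"
  is "\<lambda>e. Poly_Mapping.single (Poly_Mapping.single e 1) 1" .

definition elem_sym :: "nat \<Rightarrow> 'b set \<Rightarrow> ('b \<Rightarrow> 'c::comm_ring_1) \<Rightarrow> 'c"
  where "elem_sym k A u = (\<Sum>T\<in>{T. T \<subseteq> A \<and> card T = k}. \<Prod>e\<in>T. u e)"


section \<open>Chains and lattice paths\<close>

definition chains_between :: "'a set set \<Rightarrow> 'a set \<Rightarrow> 'a set \<Rightarrow> 'a set list set"
  where "chains_between \<S> A B =
    {C. C \<noteq> [] \<and> set C \<subseteq> \<S> \<and> sorted_wrt (\<subset>) C \<and> hd C = A \<and> last C = B}"

text \<open>
  A path is given by its list of steps.  The starting point is $(1/2, 1/2)$, so a path of $\ell$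
  steps crosses the vertical line at abscissa $a$, where $1 \le a \le \ell$, in the middle of its
  \<open>a\<close>-th step, and it passes weakly above $(a, b)$ there iff at least \<open>b\<close> of its first \<open>a\<close> steps
  go up.  This count is the definition for all points, also for those of abscissa $0$ or $> \ell$.
\<close>

definition weakly_above :: "(int \<times> int) list \<Rightarrow> int \<times> int \<Rightarrow> bool"
  where "weakly_above s pt \<longleftrightarrow>
    snd pt \<le> int (length (filter (\<lambda>d. d = (1, 1))
      (take (nat (min (fst pt) (int (length s)))) s)))"


section \<open>Matroids\<close>

locale matroid =
  fixes E :: "'a set" and indep :: "'a set \<Rightarrow> bool"
  assumes finite_ground: "finite E"
    and indep_subset_ground: "indep I \<Longrightarrow> I \<subseteq> E"
    and indep_empty: "indep {}"
    and indep_subset: "indep J \<Longrightarrow> I \<subseteq> J \<Longrightarrow> indep I"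
    and augmentation: "indep I \<Longrightarrow> indep J \<Longrightarrow> card I < card J \<Longrightarrow> \<exists>e\<in>J - I. indep (insert e I)"
begin

definition rank :: "'a set \<Rightarrow> nat"
  where "rank S = Max (card ` {I. I \<subseteq> S \<and> indep I})"

definition closure :: "'a set \<Rightarrow> 'a set"
  where "closure S = {e \<in> E. rank (insert e S) = rank S}"

definition flats :: "'a set set"
  where "flats = {F. F \<subseteq> E \<and> closure F = F}"

definition basis :: "'a set \<Rightarrow> bool"
  where "basis B \<longleftrightarrow> indep B \<and> (\<forall>e\<in>E - B. \<not> indep (insert e B))"

definition loop :: "'a \<Rightarrow> bool"
  where "loop e \<longleftrightarrow> e \<in> E \<and> \<not> indep {e}"

definition coloop :: "'a \<Rightarrow> bool"
  where "coloop e \<longleftrightarrow> e \<in> E \<and> (\<forall>B. basis B \<longrightarrow> e \<in> B)"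

definition circuit :: "'a set \<Rightarrow> bool"
  where "circuit C \<longleftrightarrow> C \<subseteq> E \<and> \<not> indep C \<and> (\<forall>e\<in>C. indep (C - {e}))"

definition connected_rel :: "('a \<times> 'a) set"
  where "connected_rel =
    {(e, f). e \<in> E \<and> f \<in> E \<and> (e = f \<or> (\<exists>C. circuit C \<and> e \<in> C \<and> f \<in> C))}"

definition num_components :: nat
  where "num_components = card (E // connected_rel)"

definition greedy_basis :: "'a list \<Rightarrow> 'a set"
  where "greedy_basis w =
    {w ! k | k. k < length w \<and> rank (set (take (Suc k) w)) > rank (set (take k w))}"

definition order_deg :: "('a list \<Rightarrow> 'a zpoly) \<Rightarrow> 'a zpoly fract"
  where "order_deg f = (\<Sum>w\<in>permutations_of_set E.
    Fract (f w) (\<Prod>i<card E - 1. Var (w ! i) - Var (w ! Suc i)))"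

text \<open>
  The coefficients of the $g$-polynomial are integers, but they are defined as sums of rational
  functions.  Hence \<open>speyer_g\<close> and the invariants derived from it are typed over the field of
  rational functions, which contains the integers via \<^const>\<open>of_int\<close>.
\<close>

definition speyer_g :: "'a zpoly fract poly"
  where "speyer_g =
    (if E = {} then 1
     else if \<exists>e. loop e \<or> coloop e then 0
     else (-1) ^ num_components * (\<Sum>i = 1..rank E. [:0, -1:] ^ i *
       [: \<Sum>j<i. order_deg (\<lambda>w.
            let B = greedy_basis w; x = Var; y = (\<lambda>e. - Var e); \<alpha> = - Var (last w)
            in \<alpha> ^ j * elem_sym (i - j - 1) (E - B) (\<lambda>e. - y e)
                * elem_sym (rank E - i) B x * elem_sym (card E - rank E) (E - B) y) :]))"

definition omega :: "'a zpoly fract"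
  where "omega = coeff speyer_g (rank E)"

definition omega_circ :: "'a zpoly fract"
  where "omega_circ = (-1) ^ (num_components - 1) * omega"

definition rank_point :: "'a set \<Rightarrow> int \<times> int"
  where "rank_point S = (int (card S) - int (rank S), int (rank S))"

text \<open>
  The required displacement from $(1/2, 1/2)$ to $(n - r - 1/2, r - 1/2)$ is an integer vector; if
  one of its entries is negative there are no paths.
\<close>

definition ferroni_paths :: "(int \<times> int) list set"
  where "ferroni_paths = {s. set s \<subseteq> {(1, 1), (1, 0)} \<and>
    sum_list s = (int (card E) - int (rank E) - 1, int (rank E) - 1)}"

end


section \<open>The sum over chains of flats in the presence of loops\<close>

text \<open>
  For a matroid with loops the invariant \<open>omega_circ\<close> vanishes, whereas the signed count of
  paths over chains of flats need not: the direct sum of a coloop and a loop, here on the ground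
  set \<open>{False, True}\<close> with loop \<open>True\<close>, has the empty path as its only path, and only one chain of
  flats, namely \<open>{True} \<subset> {False, True}\<close>.  So the formula over flats needs
  the matroid to be loopless.  The formula over all subsets does not.
\<close>

lemma matroid_coloop_loop: "matroid {False, True} (\<lambda>I. I \<subseteq> {False})"
  by standard (auto simp: subset_singleton_iff)

lemma flats_formula_fails_with_loop:
  defines "E \<equiv> {False, True}" and "indep \<equiv> \<lambda>I. I \<subseteq> {False}"
  shows "matroid.omega_circ E indep = 0"
    and "(\<Sum>C\<in>chains_between (matroid.flats E indep) (matroid.closure E indep {}) E.
      let k = length C - 1 in (-1) ^ (k - 1) *
        int (card {s \<in> matroid.ferroni_paths E indep.
          \<forall>i\<in>{1..<k}. weakly_above s (matroid.rank_point indep (C ! i))})) = 1"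
proof -
  interpret matroid E indep
    unfolding E_def indep_def by (rule matroid_coloop_loop)
  have "loop True"
    unfolding loop_def by (simp add: E_def indep_def)
  then have "speyer_g = 0"
    unfolding speyer_g_def by (auto simp: E_def)
  then show "omega_circ = 0"
    by (simp add: omega_circ_def omega_def)
  have rank: "rank S = (if False \<in> S then 1 else 0)" for S
  proof -
    have "card ` {I. I \<subseteq> S \<and> indep I} = (if False \<in> S then {0, 1} else {0})"
    proof (cases "False \<in> S")
      case True
      then have "{I. I \<subseteq> S \<and> indep I} = {{}, {False}}"
        by (auto simp: indep_def subset_singleton_iff)
      then show ?thesis
        using True by simp
    next
      case False
      then have "{I. I \<subseteq> S \<and> indep I} = {{}}"
        by (auto simp: indep_def subset_singleton_iff)
      then show ?thesis
        using False by simp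
    qed
    then show ?thesis
      by (simp add: rank_def)
  qed
  have closure: "closure S = (if False \<in> S then E else {True})" for S
    unfolding closure_def rank by (auto simp: E_def)
  have flats: "flats = {{True}, E}"
    unfolding flats_def closure by (auto simp: E_def split: if_splits)
  have E_neq: "E \<noteq> {True}" and E_psub: "{True} \<subset> E" and E_not_psub: "\<not> E \<subset> {True}"
    by (auto simp: E_def)
  have chains: "chains_between flats (closure {}) E = {[{True}, E]}"
  proof (intro equalityI subsetI)
    fix C assume "C \<in> chains_between flats (closure {}) E"
    then have C: "C \<noteq> []" "set C \<subseteq> {{True}, E}" "sorted_wrt (\<subset>) C" "hd C = {True}" "last C = E"
      by (simp_all add: chains_between_def flats closure)
    obtain D where D: "C = {True} # D"
      using C(1,4) by (metis list.collapse)
    then have "D \<noteq> []"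
      using C(5) E_neq by force
    then obtain X D' where D': "D = X # D'"
      by (metis list.exhaust)
    have "X = E"
      using C(2,3) unfolding D D' by simp blast
    have "D' = []"
    proof (cases D')
      case (Cons Y D'')
      then have "Y \<in> {{True}, E}" "E \<subset> Y"
        using C(2,3) unfolding D D' \<open>X = E\<close> by simp_all
      then show ?thesis
        using E_not_psub by blast
    qed
    then show "C \<in> {[{True}, E]}"
      using D D' \<open>X = E\<close> by simp
  next
    fix C assume "C \<in> {[{True}, E]}"
    then show "C \<in> chains_between flats (closure {}) E"
      unfolding chains_between_def flats closure using E_psub by simp
  qed
  have len: "fst (sum_list s) = int (length s)" if "set s \<subseteq> {(1, 1), (1, 0)}"
    for s :: "(int \<times> int) list"
    using that by (induction s) auto
  have "ferroni_paths = {[]}"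
  proof (intro equalityI subsetI)
    fix s assume s: "s \<in> ferroni_paths"
    then have "fst (sum_list s) = 0"
      unfolding ferroni_paths_def rank by (simp add: E_def)
    then show "s \<in> {[]}"
      using len[of s] s by (auto simp: ferroni_paths_def)
  qed (unfold ferroni_paths_def rank, simp add: E_def zero_prod_def)
  then show "(\<Sum>C\<in>chains_between flats (closure {}) E.
      let k = length C - 1 in (-1) ^ (k - 1) *
        int (card {s \<in> ferroni_paths. \<forall>i\<in>{1..<k}. weakly_above s (rank_point (C ! i))})) = 1"
    by (simp add: chains)
qed

end

theory Submission
  imports Defs "HOL-Computational_Algebra.Polynomial_Factorial"
begin

text \<open>
  In the coefficient of $t^r$ the powers of $\alpha = - z_{w_n}$ delete the variable of \<open>w\<^sub>n\<close> from
  the elementary symmetric polynomial of the complement of $B_w$, and the monomials that remain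
  correspond to the Ferroni paths, for every ordering \<open>w\<close>. The monomial belonging to a path has the
  form $\prod_i z_{w_i}^{D(S_i) - D(S_{i-1})}$ with $S_i = \{w_1, \dots, w_i\}$ and a monotone
  function \<open>D\<close> of sets, determined by the path, such that $D(S) \ge |S|$ iff the path passes weakly
  above the point of \<open>S\<close>.

  For any monotone \<open>D\<close> with $D(\emptyset) = 0$ and $D(E) = n - 1$ the sum over all orderings \<open>w\<close> of
  $\prod_i z_{w_i}^{D(S_i) - D(S_{i-1})} / \prod_i (z_{w_i} - z_{w_{i+1}})$ is $(-1)^{n-1}$ times the
  sum of $(-1)^{k-1}$ over the chains from $\emptyset$ to \<open>E\<close> through sets with $D(S) \ge |S|$, while
  it vanishes if $D(E) < n - 1$: lowering \<open>D\<close> by one at a single set \<open>S\<close> changes the sum by the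
  product of the sums for the intervals below and above \<open>S\<close>, and if \<open>D\<close> is constant on the proper
  subsets the sum is a Lagrange interpolation sum.

  Chains of flats suffice because the closure of a set below a path is again below it. If there is
  a loop or a coloop, adding or removing it in the same way shows that the sum over chains vanishes.
\<close>

section \<open>Signed sums over chains\<close>

text \<open>For \<open>a < b\<close> and finite \<open>Q\<close> this is minus the Moebius function
  from \<open>a\<close> to \<open>b\<close> of the poset \<open>Q\<close> with \<open>a\<close> and
  \<open>b\<close> adjoined (Philip Hall). Only interior members are listed: a chain with k steps
  has k - 1 of them.\<close>

definition chain_sum :: "'p::order set \<Rightarrow> 'p \<Rightarrow> 'p \<Rightarrow> int"
  where "chain_sum Q a b = (\<Sum>C\<in>{C. set C \<subseteq> Q \<inter> {a<..<b} \<and> sorted_wrt (<) C}. (-1) ^ length C)"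

lemma sorted_wrt_less_distinct: "sorted_wrt (<) C \<Longrightarrow> distinct (C :: 'p::order list)"
  by (induction C) auto

lemma finite_sorted_wrt_less:
  fixes X :: "'p::order set"
  assumes "finite X"
  shows "finite {C. set C \<subseteq> X \<and> sorted_wrt (<) C}"
  by (rule finite_subset[OF _ finite_subset_distinct[OF assms]]) (auto intro: sorted_wrt_less_distinct)

lemma chain_sum_cong:
  assumes "\<And>x. a < x \<Longrightarrow> x < b \<Longrightarrow> x \<in> Q \<longleftrightarrow> x \<in> Q'"
  shows "chain_sum Q a b = chain_sum Q' a b"
proof -
  have "Q \<inter> {a<..<b} = Q' \<inter> {a<..<b}"
    using assms by auto
  then show ?thesis
    by (simp add: chain_sum_def)
qed

text \<open>Nonempty chains are sorted by their largest member \<open>x\<close>; this is the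
  recursion of the Moebius function.\<close>

lemma chain_sum_rec:
  assumes "finite Q"
  shows "chain_sum Q a b = 1 - (\<Sum>x\<in>Q \<inter> {a<..<b}. chain_sum Q a x)"
proof -
  let ?Ch = "\<lambda>b. {C. set C \<subseteq> Q \<inter> {a<..<b} \<and> sorted_wrt (<) C}"
  let ?f = "\<lambda>x C. C @ [x]"
  have "C \<in> {[]} \<union> (\<Union>x\<in>Q \<inter> {a<..<b}. ?f x ` ?Ch x)" if "C \<in> ?Ch b" for C
  proof (cases C rule: rev_cases)
    case (snoc D x)
    then have "x \<in> Q \<inter> {a<..<b}" "D \<in> ?Ch x"
      using that by (auto simp: sorted_wrt_append)
    then show ?thesis
      using snoc by blast
  qed simp
  moreover have "C \<in> ?Ch b" if "C \<in> {[]} \<union> (\<Union>x\<in>Q \<inter> {a<..<b}. ?f x ` ?Ch x)" for C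
  proof -
    have "C = [] \<or> (\<exists>x D. C = D @ [x] \<and> x \<in> Q \<inter> {a<..<b} \<and> D \<in> ?Ch x)"
      using that by blast
    then consider "C = []" | x D where "C = D @ [x]" "x \<in> Q \<inter> {a<..<b}" "D \<in> ?Ch x"
      by blast
    then show ?thesis
    proof cases
      case 2
      then show ?thesis
        by (fastforce simp: sorted_wrt_append)
    qed simp
  qed
  ultimately have eq: "?Ch b = {[]} \<union> (\<Union>x\<in>Q \<inter> {a<..<b}. ?f x ` ?Ch x)"
    by blast
  have fin: "finite (?Ch x)" for x
    using assms by (intro finite_sorted_wrt_less) auto
  have "chain_sum Q a b = (\<Sum>C\<in>{[] :: 'a list}. (-1) ^ length C) + (\<Sum>C\<in>(\<Union>x\<in>Q \<inter> {a<..<b}. ?f x ` ?Ch x). (-1) ^ length C)"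
    unfolding chain_sum_def eq
    by (rule sum.union_disjoint) (use assms fin in auto)
  also have "(\<Sum>C\<in>(\<Union>x\<in>Q \<inter> {a<..<b}. ?f x ` ?Ch x). (-1) ^ length C)
      = (\<Sum>x\<in>Q \<inter> {a<..<b}. \<Sum>C\<in>?f x ` ?Ch x. (-1 :: int) ^ length C)"
    by (rule sum.UNION_disjoint) (use assms fin in auto)
  also have "\<dots> = (\<Sum>x\<in>Q \<inter> {a<..<b}. - chain_sum Q a x)"
    by (rule sum.cong) (simp_all add: chain_sum_def sum.reindex inj_on_def sum_negf)
  finally show ?thesis
    by (simp add: sum_negf)
qed

text \<open>The upper end of a chain sum may lie outside \<open>Q\<close>, so the induction is on
  the number of members of \<open>Q\<close> below \<open>b\<close>.\<close>

lemma finite_below_induct [consumes 1, case_names below]: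
  fixes b :: "'p::order"
  assumes "finite Q" and step: "\<And>b. (\<And>x. x \<in> Q \<Longrightarrow> x < b \<Longrightarrow> P x) \<Longrightarrow> P b"
  shows "P b"
proof (induction "card {x \<in> Q. x < b}" arbitrary: b rule: less_induct)
  case less
  show ?case
  proof (rule step)
    fix x assume "x \<in> Q" "x < b"
    then have "{y \<in> Q. y < x} \<subset> {y \<in> Q. y < b}"
      by auto
    then show "P x"
      using less assms(1) by (simp add: psubset_card_mono)
  qed
qed

text \<open>A chain through \<open>s\<close> is a chain below \<open>s\<close>, then
  \<open>s\<close>, then a chain above \<open>s\<close>; the extra member \<open>s\<close> changes
  the sign.\<close>

lemma chain_sum_insert:
  assumes "finite Q" and "s \<notin> Q" and "a < s" and "s < b"
  shows "chain_sum (insert s Q) a b = chain_sum Q a b - chain_sum Q a s * chain_sum Q s b"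
  using assms(1,4)
proof (induction b rule: finite_below_induct)
  case (below b)
  have fin: "finite (insert s Q)"
    using assms by simp
  let ?I = "Q \<inter> {a<..<b}" and ?J = "Q \<inter> {s<..<b}"
  have JI: "?J \<subseteq> ?I" and I: "insert s Q \<inter> {a<..<b} = insert s ?I" and sI: "s \<notin> ?I" and finI: "finite ?I"
    using assms below.prems by auto
  \<comment> \<open>For \<open>x\<close> not above \<open>s\<close>, \<open>x = s\<close> included,
    the new member lies outside the interval from \<open>a\<close> to \<open>x\<close>.\<close>
  have *: "chain_sum (insert s Q) a x = chain_sum Q a x - (if s < x then chain_sum Q a s * chain_sum Q s x else 0)"
    if "x \<in> insert s ?I" for x
  proof (cases "s < x")
    case True
    then show ?thesis
      using below.IH[of x] that by auto
  next
    case False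
    then have "chain_sum (insert s Q) a x = chain_sum Q a x"
      by (intro chain_sum_cong) auto
    then show ?thesis
      using False by simp
  qed
  have "(\<Sum>x\<in>insert s Q \<inter> {a<..<b}. chain_sum (insert s Q) a x)
      = chain_sum Q a s + (\<Sum>x\<in>?I. chain_sum Q a x - (if s < x then chain_sum Q a s * chain_sum Q s x else 0))"
    using * finI sI unfolding I by simp
  also have "\<dots> = chain_sum Q a s + (\<Sum>x\<in>?I. chain_sum Q a x)
      - chain_sum Q a s * (\<Sum>x\<in>?J. chain_sum Q s x)"
  proof -
    have "(\<Sum>x\<in>?I. if s < x then chain_sum Q a s * chain_sum Q s x else 0)
        = (\<Sum>x\<in>?J. chain_sum Q a s * chain_sum Q s x)"
      using finI assms(3) by (intro sum.mono_neutral_cong_right) auto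
    then show ?thesis
      by (simp add: sum_subtractf sum_distrib_left)
  qed
  finally show ?case
    unfolding chain_sum_rec[OF fin, of a b] chain_sum_rec[OF assms(1), of a b]
      chain_sum_rec[OF assms(1), of s b]
    by (simp add: algebra_simps)
qed

text \<open>Rota's theorem on Moebius functions: \<open>c\<close> is a closure operator on the open
  interval, and the terms of the recursion are grouped by the fibres of \<open>c\<close>.\<close>

lemma chain_sum_closure:
  assumes fin: "finite Q" 
    and closed: "\<And>x. x \<in> Q \<inter> {a<..<b} \<Longrightarrow> c x \<in> Q \<inter> {a<..<b}"
    and ext: "\<And>x. x \<in> Q \<inter> {a<..<b} \<Longrightarrow> x \<le> c x"
    and mono: "\<And>x y. x \<in> Q \<inter> {a<..<b} \<Longrightarrow> y \<in> Q \<inter> {a<..<b} \<Longrightarrow> x \<le> y \<Longrightarrow> c x \<le> c y"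
    and idem: "\<And>x. x \<in> Q \<inter> {a<..<b} \<Longrightarrow> c (c x) = c x"
  shows "chain_sum Q a b = chain_sum {x \<in> Q. c x = x} a b"
proof -
  define X where "X = Q \<inter> {a<..<b}"
  define K where "K = {x \<in> Q. c x = x}"
  have finX: "finite X" and finK: "finite K"
    using fin by (auto simp: X_def K_def)
  \<comment> \<open>The sums over fibres satisfy the recursion that determines the chain sums of the
    closed elements.\<close>
  have fib: "(\<Sum>y\<in>{y \<in> X. c y = x}. chain_sum Q a y) = chain_sum K a x" if "x \<in> K \<inter> {a<..<b}" for x
    using finK that
  proof (induction x rule: finite_below_induct)
    case (below x)
    have x: "x \<in> X" "c x = x" "x \<in> Q" "a < x" "x < b"
      using below.prems by (auto simp: X_def K_def)
    have le: "c y \<le> x \<longleftrightarrow> y \<le> x" if "y \<in> X" for y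
    proof
      assume "c y \<le> x" 
      then show "y \<le> x" using ext[of y] that unfolding X_def by (metis order.trans)
    next
      assume "y \<le> x"
      then show "c y \<le> x" using mono[of y x] x that by (simp add: X_def)
    qed
    have lower: "{y \<in> X. y \<le> x} = insert x (Q \<inter> {a<..<x})"
      using x by (auto simp: X_def)
    \<comment> \<open>The recursion at \<open>x\<close>, with the term of \<open>x\<close> itself
      moved to the other side.\<close>
    have "(\<Sum>y\<in>{y \<in> X. y \<le> x}. chain_sum Q a y) = 1"
      using fin unfolding lower by (simp add: chain_sum_rec[OF fin, of a x])
    moreover have "(\<Sum>y\<in>{y \<in> X. y \<le> x}. chain_sum Q a y)
        = (\<Sum>t\<in>{t \<in> K \<inter> {a<..<b}. t \<le> x}. \<Sum>y\<in>{y \<in> {y \<in> X. y \<le> x}. c y = t}. chain_sum Q a y)"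
      using fin finX finK le closed idem
      by (intro sum.group[symmetric]) (auto simp: X_def K_def)
    moreover have "\<dots> = (\<Sum>t\<in>{t \<in> K \<inter> {a<..<b}. t \<le> x}. \<Sum>y\<in>{y \<in> X. c y = t}. chain_sum Q a y)"
    proof (rule sum.cong[OF refl])
      fix t assume "t \<in> {t \<in> K \<inter> {a<..<b}. t \<le> x}"
      then have "{y \<in> {y \<in> X. y \<le> x}. c y = t} = {y \<in> X. c y = t}"
        using le by auto
      then show "(\<Sum>y\<in>{y \<in> {y \<in> X. y \<le> x}. c y = t}. chain_sum Q a y) = (\<Sum>y\<in>{y \<in> X. c y = t}. chain_sum Q a y)"
        by simp
    qed
    moreover have "{t \<in> K \<inter> {a<..<b}. t \<le> x} = insert x (K \<inter> {a<..<x})"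
      using below.prems by auto
    moreover have "(\<Sum>t\<in>K \<inter> {a<..<x}. \<Sum>y\<in>{y \<in> X. c y = t}. chain_sum Q a y) = (\<Sum>t\<in>K \<inter> {a<..<x}. chain_sum K a t)"
      using below x(5) by (intro sum.cong) auto
    ultimately show ?case
      using finK by (simp add: chain_sum_rec[OF finK, of a x])
  qed
  have "(\<Sum>y\<in>X. chain_sum Q a y) = (\<Sum>t\<in>K \<inter> {a<..<b}. \<Sum>y\<in>{y \<in> X. c y = t}. chain_sum Q a y)"
    using fin finX finK closed idem by (intro sum.group[symmetric]) (auto simp: X_def K_def)
  then have "(\<Sum>y\<in>X. chain_sum Q a y) = (\<Sum>t\<in>K \<inter> {a<..<b}. chain_sum K a t)"
    using fib by simp
  then show ?thesis
    unfolding K_def[symmetric] chain_sum_rec[OF fin, of a b] chain_sum_rec[OF finK, of a b] X_def by simp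
qed

text \<open>In the recursion \<open>m\<close> contributes 1, having nothing below it, and every
  other member contributes 0 by induction.\<close>

lemma chain_sum_least_eq_0:
  assumes fin: "finite Q" and m: "m \<in> Q" "a < m" and "m < b"
    and least: "\<And>x. x \<in> Q \<Longrightarrow> a < x \<Longrightarrow> x < b \<Longrightarrow> m \<le> x"
  shows "chain_sum Q a b = 0"
  using fin \<open>m < b\<close> least
proof (induction b rule: finite_below_induct)
  case (below b)
  have "Q \<inter> {a<..<m} = {}"
  proof (rule equals0I)
    fix x assume x: "x \<in> Q \<inter> {a<..<m}"
    then have "m \<le> x"
      using below.prems(1) by (intro below.prems(2)) (auto intro: order.strict_trans)
    then show False
      using x leD by auto
  qed
  then have "chain_sum Q a m = 1"
    using chain_sum_rec[OF fin, of a m] by simp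
  moreover have "(\<Sum>x\<in>Q \<inter> {a<..<b} - {m}. chain_sum Q a x) = 0"
  proof (rule sum.neutral, rule ballI)
    fix x assume x: "x \<in> Q \<inter> {a<..<b} - {m}"
    then have "m < x"
      using below.prems(2)[of x] by auto
    then show "chain_sum Q a x = 0"
      using x below.prems by (intro below.IH) auto
  qed
  moreover have "(\<Sum>x\<in>Q \<inter> {a<..<b}. chain_sum Q a x) = chain_sum Q a m + (\<Sum>x\<in>Q \<inter> {a<..<b} - {m}. chain_sum Q a x)"
    using fin m below.prems by (intro sum.remove) auto
  ultimately show ?case
    unfolding chain_sum_rec[OF fin, of a b] by simp
qed

text \<open>In the recursion for \<open>T\<close> the sets containing \<open>e\<close> contribute 0 by induction, and the others are the
  members of \<open>Q\<close> up to \<open>T - {e}\<close>, whose contributions add up to 1 by the recursion for \<open>T - {e}\<close>.\<close>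

lemma chain_sum_deletion_eq_0:
  assumes fin: "finite Q" and sing: "{e} \<notin> Q"
    and del: "\<And>S. S \<in> Q \<Longrightarrow> e \<in> S \<Longrightarrow> S - {e} \<in> Q"
    and "e \<in> T" "T - {e} \<in> Q" "T \<noteq> {e}"
  shows "chain_sum Q {} T = 0"
  using fin assms(4-6)
proof (induction T rule: finite_below_induct)
  case (below T)
  let ?X = "T - {e}"
  let ?L = "insert ?X (Q \<inter> {{}<..<?X})" and ?R = "{S \<in> Q. S < T \<and> e \<in> S}"
  have "?X \<noteq> {}"
    using below.prems by auto
  then have eq: "Q \<inter> {{}<..<T} = ?L \<union> ?R"
  proof (intro set_eqI iffI)
    fix S assume "S \<in> Q \<inter> {{}<..<T}"
    then have S: "S \<in> Q" "S \<noteq> {}" "S \<subset> T"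
      by auto
    show "S \<in> ?L \<union> ?R"
    proof (cases "e \<in> S \<or> S = ?X")
      case True
      with S show ?thesis by auto
    next
      case False
      then have "S \<subset> ?X"
        using S(3) by blast
      with S show ?thesis by auto
    qed
  next
    fix S assume S: "S \<in> ?L \<union> ?R"
    have X: "?X \<in> Q \<inter> {{}<..<T}"
      using below.prems(1,2) \<open>?X \<noteq> {}\<close> by auto
    show "S \<in> Q \<inter> {{}<..<T}"
    proof (cases "S = ?X \<or> S \<in> ?R")
      case True
      with X show ?thesis by auto
    next
      case False
      then have "S \<in> Q \<inter> {{}<..<?X}"
        using S by blast
      then have "S \<in> Q" "{} < S" "S < ?X"
        by auto
      moreover have "?X < T"
        using X by simp
      ultimately show ?thesis by simp
    qed
  qed
  have "(\<Sum>S\<in>Q \<inter> {{}<..<T}. chain_sum Q {} S) = (\<Sum>S\<in>?L. chain_sum Q {} S) + (\<Sum>S\<in>?R. chain_sum Q {} S)"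
    unfolding eq
  proof (rule sum.union_disjoint)
    have "e \<notin> S" if "S \<in> ?L" for S
      using that by auto
    then show "?L \<inter> ?R = {}"
      by blast
  qed (simp_all add: fin)
  also have "(\<Sum>S\<in>?L. chain_sum Q {} S) = 1"
    using fin chain_sum_rec[OF fin, of "{}" ?X] by (subst sum.insert) simp_all
  also have "(\<Sum>S\<in>?R. chain_sum Q {} S) = 0"
  proof (rule sum.neutral, rule ballI)
    fix S assume "S \<in> ?R"
    then have S: "S \<in> Q" "S < T" "e \<in> S"
      by simp_all
    \<comment> \<open>Induction needs \<open>S - {e}\<close> to be nonempty, hence the exclusion of
      \<open>{e}\<close> from \<open>Q\<close>.\<close>
    moreover have "S \<noteq> {e}"
      using S(1) sing by blast
    ultimately show "chain_sum Q {} S = 0"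
      by (intro below.IH del)
  qed
  finally show ?case
    using chain_sum_rec[OF fin, of "{}" T] by simp
qed

section \<open>Sums over orderings of a finite set\<close>

fun diff_prod :: "('a \<Rightarrow> 'k::comm_ring_1) \<Rightarrow> 'a list \<Rightarrow> 'k" where
  "diff_prod z (x # y # w) = (z x - z y) * diff_prod z (y # w)"
| "diff_prod z w = 1"

text \<open>The exponents are truncated differences, so this is the intended monomial only for a \<open>D\<close> that is
  monotone along the flag.\<close>

primrec flag_monom :: "('a \<Rightarrow> 'k::comm_ring_1) \<Rightarrow> ('a set \<Rightarrow> nat) \<Rightarrow> 'a set \<Rightarrow> 'a list \<Rightarrow> 'k" where
  "flag_monom z D A [] = 1"
| "flag_monom z D A (x # w) = z x ^ (D (insert x A) - D A) * flag_monom z D (insert x A) w"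

text \<open>Orderings of \<open>B - A\<close> are the maximal flags from \<open>A\<close> to
  \<open>B\<close>. Attaching the sum to an interval lets it be split at an intermediate
  set.\<close>

definition order_sum :: "('a \<Rightarrow> 'k::field) \<Rightarrow> ('a set \<Rightarrow> nat) \<Rightarrow> 'a set \<Rightarrow> 'a set \<Rightarrow> 'k"
  where "order_sum z D A B = (\<Sum>w\<in>permutations_of_set (B - A). flag_monom z D A w / diff_prod z w)"

lemma diff_prod_append:
  "diff_prod z (u @ x # y # v) = diff_prod z (u @ [x]) * (z x - z y) * diff_prod z (y # v)"
  by (induction z u rule: diff_prod.induct) simp_all

lemma diff_prod_snoc2: "diff_prod z (u @ [x, y]) = diff_prod z (u @ [x]) * (z x - z y)"
  using diff_prod_append[of z u x y "[]"] by simp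

lemma diff_prod_nonzero:
  fixes z :: "'a \<Rightarrow> 'k::field"
  assumes "distinct w" and "inj_on z (set w)"
  shows "diff_prod z w \<noteq> 0"
  using assms by (induction z w rule: diff_prod.induct) (auto simp: inj_on_def)

lemma diff_prod_conv_nth: "diff_prod z w = (\<Prod>i<length w - 1. z (w ! i) - z (w ! Suc i))"
  by (induction z w rule: diff_prod.induct) (simp_all add: prod.lessThan_Suc_shift del: prod.lessThan_Suc)

lemma flag_monom_append: "flag_monom z D A (u @ v) = flag_monom z D A u * flag_monom z D (A \<union> set u) v"
  by (induction u arbitrary: A) (auto simp: algebra_simps)

lemma flag_monom_cong:
  assumes "\<And>u v. w = u @ v \<Longrightarrow> D (A \<union> set u) = D' (A \<union> set u)"
  shows "flag_monom z D A w = flag_monom z D' A w"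
  using assms
proof (induction w arbitrary: A)
  case (Cons x w)
  have "D A = D' A" "D (insert x A) = D' (insert x A)"
    using Cons.prems[of "[]" "x # w"] Cons.prems[of "[x]" w] by auto
  moreover have "flag_monom z D (insert x A) w = flag_monom z D' (insert x A) w"
    using Cons.prems[of "x # _"] by (intro Cons.IH) auto
  ultimately show ?case
    by simp
qed simp

lemma sum_permutations_of_set_snoc:
  assumes "finite X" and "X \<noteq> {}"
  shows "(\<Sum>w\<in>permutations_of_set X. f w) = (\<Sum>b\<in>X. \<Sum>u\<in>permutations_of_set (X - {b}). f (u @ [b]))"
proof -
  have "(\<Sum>w\<in>permutations_of_set X. f w) = (\<Sum>b\<in>X. \<Sum>w\<in>{w \<in> permutations_of_set X. last w = b}. f w)"
  proof (rule sum.group[symmetric])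
    show "last ` permutations_of_set X \<subseteq> X"
    proof (rule image_subsetI)
      fix w assume "w \<in> permutations_of_set X"
      then show "last w \<in> X"
        using assms(2) by (metis last_in_set permutations_of_setD(1) set_empty)
    qed
  qed (simp_all add: assms(1))
  also have "\<dots> = (\<Sum>b\<in>X. \<Sum>u\<in>permutations_of_set (X - {b}). f (u @ [b]))"
  proof (rule sum.cong[OF refl])
    fix b assume "b \<in> X"
    have "{w \<in> permutations_of_set X. last w = b} = (\<lambda>u. u @ [b]) ` permutations_of_set (X - {b})"
    proof (intro set_eqI iffI)
      fix w assume "w \<in> {w \<in> permutations_of_set X. last w = b}"
      then show "w \<in> (\<lambda>u. u @ [b]) ` permutations_of_set (X - {b})"
        using assms(2) by (cases w rule: rev_cases) (auto simp: permutations_of_set_def)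
    next
      fix w assume "w \<in> (\<lambda>u. u @ [b]) ` permutations_of_set (X - {b})"
      then obtain u where u: "w = u @ [b]" "set u = X - {b}" "distinct u"
        by (auto simp: permutations_of_set_def)
      then show "w \<in> {w \<in> permutations_of_set X. last w = b}"
        using \<open>b \<in> X\<close> by (simp add: permutations_of_set_def insert_absorb)
    qed
    then show "(\<Sum>w\<in>{w \<in> permutations_of_set X. last w = b}. f w) = (\<Sum>u\<in>permutations_of_set (X - {b}). f (u @ [b]))"
      by (simp add: sum.reindex inj_on_def)
  qed
  finally show ?thesis .
qed

lemma sum_permutations_of_set_split:
  assumes fin: "finite Y" and YX: "Y \<subseteq> X"
  shows "(\<Sum>w\<in>{w \<in> permutations_of_set X. \<exists>u v. w = u @ v \<and> set u = Y}. f w)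
    = (\<Sum>u\<in>permutations_of_set Y. \<Sum>v\<in>permutations_of_set (X - Y). f (u @ v))"
proof -
  have eq: "{w \<in> permutations_of_set X. \<exists>u v. w = u @ v \<and> set u = Y}
    = (\<lambda>(u, v). u @ v) ` (permutations_of_set Y \<times> permutations_of_set (X - Y))"
  proof (intro set_eqI iffI)
    fix w assume "w \<in> {w \<in> permutations_of_set X. \<exists>u v. w = u @ v \<and> set u = Y}"
    then obtain u v where "w = u @ v" "u \<in> permutations_of_set Y" "v \<in> permutations_of_set (X - Y)"
      by (fastforce simp: permutations_of_set_def)
    then show "w \<in> (\<lambda>(u, v). u @ v) ` (permutations_of_set Y \<times> permutations_of_set (X - Y))"
      by (intro image_eqI[where x = "(u, v)"]) simp_all
  next
    fix w assume "w \<in> (\<lambda>(u, v). u @ v) ` (permutations_of_set Y \<times> permutations_of_set (X - Y))"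
    then obtain u v where uv: "w = u @ v" "u \<in> permutations_of_set Y" "v \<in> permutations_of_set (X - Y)"
      by auto
    then have "w \<in> permutations_of_set X" "set u = Y"
      using YX by (auto simp: permutations_of_set_def)
    with uv(1) show "w \<in> {w \<in> permutations_of_set X. \<exists>u v. w = u @ v \<and> set u = Y}"
      by blast
  qed
  have "inj_on (\<lambda>(u, v). u @ v) (permutations_of_set Y \<times> permutations_of_set (X - Y))"
    by (auto simp: inj_on_def length_finite_permutations_of_set)
  then show ?thesis
    unfolding eq by (simp add: sum.reindex sum.cartesian_product case_prod_unfold)
qed

section \<open>Lagrange interpolation sums\<close>

definition lagrange_sum :: "('a \<Rightarrow> 'k::field) \<Rightarrow> nat \<Rightarrow> 'a set \<Rightarrow> 'k"
  where "lagrange_sum z m X = (\<Sum>b\<in>X. z b ^ m * (\<Prod>a\<in>X - {b}. 1 / (z a - z b)))"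

text \<open>The factor \<open>z x - z b\<close> kills the term of \<open>x\<close> and cancels the
  factor of \<open>x\<close> in every other term.\<close>

lemma lagrange_sum_remove:
  assumes "finite X" and "x \<in> X" and inj: "inj_on z X"
  shows "lagrange_sum z m (X - {x}) = (\<Sum>b\<in>X. (z x - z b) * (z b ^ m * (\<Prod>a\<in>X - {b}. 1 / (z a - z b))))"
proof -
  have "(z x - z b) * (z b ^ m * (\<Prod>a\<in>X - {b}. 1 / (z a - z b))) = z b ^ m * (\<Prod>a\<in>X - {x} - {b}. 1 / (z a - z b))"
    if "b \<in> X - {x}" for b
  proof -
    have "(\<Prod>a\<in>X - {b}. 1 / (z a - z b)) = 1 / (z x - z b) * (\<Prod>a\<in>X - {b} - {x}. 1 / (z a - z b))"
      using assms that by (intro prod.remove) auto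
    moreover have "X - {b} - {x} = X - {x} - {b}"
      by auto
    moreover have "z x \<noteq> z b"
      using that assms by (auto simp: inj_on_def)
    ultimately show ?thesis
      by simp
  qed
  then have "lagrange_sum z m (X - {x}) = (\<Sum>b\<in>X - {x}. (z x - z b) * (z b ^ m * (\<Prod>a\<in>X - {b}. 1 / (z a - z b))))"
    unfolding lagrange_sum_def by (intro sum.cong) (simp_all only:)
  then show ?thesis
    using assms(1,2) by (simp add: sum.remove[of X x])
qed

text \<open>Up to the sign (-1)^(card X - 1) this is the divided difference of t^m at the nodes
  \<open>z b\<close>: 0 below degree card X - 1, and the leading coefficient 1 in that
  degree.\<close>

lemma lagrange_sum_eq:
  assumes "finite X" and "X \<noteq> {}" and "inj_on z X" and "m < card X"
  shows "lagrange_sum z m X = (if Suc m = card X then (-1) ^ m else 0)"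
  using assms
proof (induction "card X" arbitrary: X m rule: less_induct)
  case less
  note fin = less.prems(1) and inj = less.prems(3)
  obtain x where x: "x \<in> X"
    using less.prems by blast
  show ?case
  proof (cases "X = {x}")
    case True
    then show ?thesis
      using less.prems by (simp add: lagrange_sum_def)
  next
    case False
    then obtain y where y: "y \<in> X" "y \<noteq> x"
      using x by blast
    have IH: "lagrange_sum z m (X - {b}) = (if Suc m = card (X - {b}) then (-1) ^ m else 0)"
      if "b \<in> X" "Suc m < card X" for b m
      using that less.prems x y by (intro less.hyps) (auto intro: inj_on_subset)
    have small: "lagrange_sum z m X = 0" if m: "Suc m < card X" for m
    proof -
      \<comment> \<open>The recursion of divided differences. The two smaller sums agree, since by
        induction they depend only on \<open>m\<close> and the number of nodes.\<close>
      have "(z x - z y) * lagrange_sum z m X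
          = (\<Sum>b\<in>X. (z x - z b) * (z b ^ m * (\<Prod>a\<in>X - {b}. 1 / (z a - z b))))
            - (\<Sum>b\<in>X. (z y - z b) * (z b ^ m * (\<Prod>a\<in>X - {b}. 1 / (z a - z b))))"
        unfolding lagrange_sum_def sum_distrib_left sum_subtractf[symmetric] left_diff_distrib[symmetric] by simp
      also have "\<dots> = lagrange_sum z m (X - {x}) - lagrange_sum z m (X - {y})"
        using lagrange_sum_remove[OF fin _ inj] x y by simp
      also have "\<dots> = 0"
        using IH[OF x m] IH[OF y(1) m] x y fin by simp
      finally show ?thesis
        using x y inj by (auto simp: inj_on_def)
    qed
    show ?thesis
    proof (cases "Suc m = card X")
      case True
      have "card X \<ge> 2"
        using x y fin card_le_Suc0_iff_eq[OF fin] by (metis not_less_eq_eq numeral_2_eq_2)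
      then obtain k where k: "m = Suc k"
        using True by (cases m) auto
      \<comment> \<open>This is \<open>z b ^ Suc k = z x * z b ^ k - (z x - z b) * z b ^ k\<close>
        in each term.\<close>
      have "lagrange_sum z m X = z x * lagrange_sum z k X - lagrange_sum z k (X - {x})"
        unfolding lagrange_sum_remove[OF fin x inj] unfolding lagrange_sum_def sum_distrib_left sum_subtractf[symmetric] k
        by (simp add: left_diff_distrib[symmetric] mult.assoc)
      also have "\<dots> = (-1) ^ m"
        using small[of k] IH[OF x, of k] True k x fin by simp
      finally show ?thesis
        using True by simp
    next
      case False
      then show ?thesis
        using small[of m] less.prems(4) by simp
    qed
  qed
qed

text \<open>Splitting by the element \<open>c\<close> just before \<open>b\<close> leaves, by
  induction, a partial fraction expansion, which amounts to the vanishing of the Lagrange sum of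
  exponent 0 on \<open>insert b X\<close>.\<close>

lemma sum_orders_last:
  fixes z :: "'a \<Rightarrow> 'k::field"
  assumes "finite X" and "b \<notin> X" and "inj_on z (insert b X)"
  shows "(\<Sum>u\<in>permutations_of_set X. 1 / diff_prod z (u @ [b])) = (\<Prod>a\<in>X. 1 / (z a - z b))"
  using assms
proof (induction "card X" arbitrary: X b rule: less_induct)
  case less
  note fin = less.prems(1) and inj = less.prems(3)
  show ?case
  proof (cases "X = {}")
    case False
    have neq: "z c \<noteq> z b" if "c \<in> X" for c
      using that less.prems by (auto simp: inj_on_def)
    have "(\<Sum>u\<in>permutations_of_set X. 1 / diff_prod z (u @ [b]))
        = (\<Sum>c\<in>X. \<Sum>u\<in>permutations_of_set (X - {c}). 1 / diff_prod z (u @ [c]) * (1 / (z c - z b)))"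
      unfolding sum_permutations_of_set_snoc[OF fin False]
      by (intro sum.cong refl) (simp add: diff_prod_snoc2)
    also have "\<dots> = (\<Sum>c\<in>X. (\<Prod>a\<in>X - {c}. 1 / (z a - z c)) * (1 / (z c - z b)))"
    proof (rule sum.cong[OF refl])
      fix c assume c: "c \<in> X"
      then have "(\<Sum>u\<in>permutations_of_set (X - {c}). 1 / diff_prod z (u @ [c])) = (\<Prod>a\<in>X - {c}. 1 / (z a - z c))"
        using less.prems(1) inj_on_subset[OF inj, of X]
        by (intro less.hyps card_Diff1_less) (simp_all add: insert_absorb subset_insertI)
      then show "(\<Sum>u\<in>permutations_of_set (X - {c}). 1 / diff_prod z (u @ [c]) * (1 / (z c - z b)))
          = (\<Prod>a\<in>X - {c}. 1 / (z a - z c)) * (1 / (z c - z b))"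
        by (simp only: sum_distrib_right[symmetric])
    qed
    also have "\<dots> = (\<Prod>a\<in>X. 1 / (z a - z b)) - lagrange_sum z 0 (insert b X)"
    proof -
      have "(\<Prod>a\<in>insert b X - {c}. 1 / (z a - z c)) = - ((\<Prod>a\<in>X - {c}. 1 / (z a - z c)) * (1 / (z c - z b)))"
        if c: "c \<in> X" for c
      proof -
        have "insert b X - {c} = insert b (X - {c})" "b \<notin> X - {c}"
          using c less.prems by auto
        moreover have "1 / (z b - z c) = - (1 / (z c - z b))"
          by (metis minus_diff_eq minus_divide_right)
        ultimately show ?thesis
          using fin by simp
      qed
      moreover have "insert b X - {b} = X"
        using less.prems by auto
      ultimately show ?thesis
        using less.prems by (simp add: lagrange_sum_def sum_negf)
    qed
    also have "lagrange_sum z 0 (insert b X) = 0"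
      using less.prems False lagrange_sum_eq[of "insert b X" z 0] by simp
    finally show ?thesis
      by simp
  qed simp
qed

section \<open>Order sums of monotone set functions\<close>

lemma flag_monom_const: "flag_monom z (\<lambda>_. d) A w = 1"
  by (induction w arbitrary: A) auto

text \<open>Only the last step of a flag, the one entering \<open>B\<close>, can have a positive
  exponent, so the orderings are grouped by their last element.\<close>

lemma order_sum_const:
  assumes fin: "finite B" and "A \<subset> B" and inj: "inj_on z (B - A)"
    and const: "\<And>T. A \<subset> T \<Longrightarrow> T \<subset> B \<Longrightarrow> D T = D A"
  shows "order_sum z D A B = lagrange_sum z (D B - D A) (B - A)"
proof -
  let ?X = "B - A"
  have X: "finite ?X" "?X \<noteq> {}"
    using assms by auto
  have monom: "flag_monom z D A (u @ [b]) = z b ^ (D B - D A)"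
    if b: "b \<in> ?X" and u: "u \<in> permutations_of_set (?X - {b})" for u b
  proof -
    have set_u: "set u = ?X - {b}"
      using u by (simp add: permutations_of_set_def)
    have below: "D (A \<union> set v) = D A" if "set v \<subseteq> set u" for v
    proof (cases "set v \<subseteq> A")
      case True
      then show ?thesis
        by (simp add: Un_absorb2)
    next
      case False
      then have "A \<subset> A \<union> set v"
        by blast
      moreover have "A \<union> set v \<subset> B"
        using that b set_u assms(2) by blast
      ultimately show ?thesis
        by (rule const)
    qed
    have "flag_monom z D A u = flag_monom z (\<lambda>_. D A) A u"
      by (rule flag_monom_cong) (simp add: below)
    moreover have "insert b (A \<union> set u) = B"
      using b set_u assms(2) by blast
    ultimately show ?thesis
      using below[of u] by (simp add: flag_monom_append flag_monom_const)
  qed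
  have "order_sum z D A B = (\<Sum>b\<in>?X. \<Sum>u\<in>permutations_of_set (?X - {b}). z b ^ (D B - D A) * (1 / diff_prod z (u @ [b])))"
    unfolding order_sum_def sum_permutations_of_set_snoc[OF X]
    by (intro sum.cong refl) (simp add: monom)
  also have "\<dots> = lagrange_sum z (D B - D A) ?X"
    unfolding lagrange_sum_def sum_distrib_left[symmetric]
  proof (intro sum.cong refl arg_cong[where f = "(*) _"])
    fix b assume b: "b \<in> ?X"
    then have "insert b (?X - {b}) = ?X"
      by blast
    then show "(\<Sum>u\<in>permutations_of_set (?X - {b}). 1 / diff_prod z (u @ [b])) = (\<Prod>a\<in>?X - {b}. 1 / (z a - z b))"
      using fin inj by (intro sum_orders_last) simp_all
  qed
  finally show ?thesis .
qed

text \<open>Raising \<open>D S\<close> by one multiplies the terms of the orderings through \<open>S\<close> by \<open>z x / z y\<close>, where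
  \<open>x\<close> and \<open>y\<close> are the elements just before and after \<open>S\<close>; the difference cancels the factor \<open>z x - z y\<close>
  of the denominator and so splits into a product.\<close>

lemma order_sum_step:
  assumes fin: "finite B" and S: "A \<subset> S" "S \<subset> B" and inj: "inj_on z (B - A)"
    and mono: "mono_on {A..B} D" and pos: "\<And>T. A \<subseteq> T \<Longrightarrow> T \<subset> S \<Longrightarrow> D T < D S"
  shows "order_sum z D A B = order_sum z (D(S := D S - 1)) A B + order_sum z (D(S := D S - 1)) A S * order_sum z D S B"
proof -
  define D' where "D' = D(S := D S - 1)"
  let ?P = "permutations_of_set (B - A)"
  let ?T = "{w \<in> ?P. \<exists>u v. w = u @ v \<and> set u = S - A}"
  have BS: "B - A - (S - A) = B - S"
    using S by blast
  have split: "(\<Sum>w\<in>?P. f w) = (\<Sum>u\<in>permutations_of_set (S - A). \<Sum>v\<in>permutations_of_set (B - S). f (u @ v))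
      + (\<Sum>w\<in>?P - ?T. f w)" for f :: "'a list \<Rightarrow> 'b"
  proof -
    have "(\<Sum>w\<in>?P. f w) = (\<Sum>w\<in>?T. f w) + (\<Sum>w\<in>?P - ?T. f w)"
      by (subst add.commute) (rule sum.subset_diff, auto)
    then show ?thesis
      using sum_permutations_of_set_split[of "S - A" "B - A" f] S fin
      unfolding BS by (auto intro: finite_subset)
  qed
  have other: "flag_monom z D A w = flag_monom z D' A w" if w: "w \<in> ?P - ?T" for w
  proof (rule flag_monom_cong)
    fix u v assume uv: "w = u @ v"
    have "set u \<subseteq> B - A"
      using w uv by (auto simp: permutations_of_set_def)
    then have "A \<union> set u \<noteq> S"
      using w uv by blast
    then show "D (A \<union> set u) = D' (A \<union> set u)"
      by (simp add: D'_def)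
  qed
  have through: "flag_monom z D A (u @ v) / diff_prod z (u @ v) = flag_monom z D' A (u @ v) / diff_prod z (u @ v)
      + (flag_monom z D' A u / diff_prod z u) * (flag_monom z D S v / diff_prod z v)"
    if u: "u \<in> permutations_of_set (S - A)" and v: "v \<in> permutations_of_set (B - S)" for u v
  proof -
    have set_u: "set u = S - A" and set_v: "set v = B - S" and d: "distinct u" "distinct v"
      using u v by (auto simp: permutations_of_set_def)
    obtain u' x where u': "u = u' @ [x]"
      using set_u S by (cases u rule: rev_cases) auto
    obtain y v' where v': "v = y # v'"
      using set_v S by (cases v) auto
    let ?R = "A \<union> set u'"
    have R: "A \<subseteq> ?R" "?R \<subset> S" and Rx: "insert x ?R = S" and AS: "A \<union> set u = S"
      using set_u d u' S by auto
    have y: "y \<in> B" "y \<notin> S"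
      using set_v v' by auto
    \<comment> \<open>Together with \<open>pos\<close> this makes the exponents around
      \<open>S\<close> genuine differences: \<open>Suc j\<close> and \<open>k\<close> for
      \<open>D\<close>, but \<open>j\<close> and \<open>Suc k\<close> for \<open>D'\<close>.\<close>
    have "D S \<le> D (insert y S)"
      by (rule mono_onD[OF mono]) (use y S in auto)
    then obtain k where k: "D (insert y S) = D S + k"
      using le_Suc_ex by blast
    obtain j where j: "D S = Suc (D ?R + j)"
      using pos[OF R] less_imp_Suc_add by blast
    have D': "D' ?R = D ?R" "D' S = D ?R + j" "D' (insert y S) = D S + k"
    proof -
      have "?R \<noteq> S" "insert y S \<noteq> S"
        using R(2) y by blast+
      then show "D' ?R = D ?R" "D' S = D ?R + j" "D' (insert y S) = D S + k"
        unfolding D'_def using k j by simp_all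
    qed
    have P: "flag_monom z D A u' = flag_monom z D' A u'"
    proof (rule flag_monom_cong)
      fix a b assume "u' = a @ b"
      then have "A \<union> set a \<noteq> S"
        using R(2) by auto
      then show "D (A \<union> set a) = D' (A \<union> set a)"
        by (simp add: D'_def)
    qed
    have Q: "flag_monom z D (insert y S) v' = flag_monom z D' (insert y S) v'"
    proof (rule flag_monom_cong)
      fix a b assume "v' = a @ b"
      have "insert y S \<union> set a \<noteq> S"
        using y by auto
      then show "D (insert y S \<union> set a) = D' (insert y S \<union> set a)"
        by (simp add: D'_def)
    qed
    define p q where "p = flag_monom z D' A u'" and "q = flag_monom z D' (insert y S) v'"
    have m: "flag_monom z D A (u @ v) = p * z x ^ Suc j * (z y ^ k * q)"
        "flag_monom z D' A (u @ v) = p * z x ^ j * (z y ^ Suc k * q)"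
        "flag_monom z D' A u = p * z x ^ j" "flag_monom z D S v = z y ^ k * q"
      unfolding flag_monom_append AS
      by (simp_all add: u' v' flag_monom_append Rx[simplified] D' k j P Q p_def q_def)
    have dp: "diff_prod z (u @ v) = diff_prod z u * (z x - z y) * diff_prod z v"
      using diff_prod_append[of z u' x y v'] u' v' by simp
    have "x \<in> B - A" "y \<in> B - A" "x \<noteq> y" "set u \<subseteq> B - A" "set v \<subseteq> B - A"
      using set_u set_v u' v' S by auto
    then have nz: "diff_prod z u \<noteq> 0" "diff_prod z v \<noteq> 0" "z x - z y \<noteq> 0"
      using d inj_on_subset[OF inj] by (simp_all add: diff_prod_nonzero inj_on_eq_iff[OF inj])
    show ?thesis
      using nz unfolding m dp by (simp add: field_simps)
  qed
  have "order_sum z D A B = (\<Sum>u\<in>permutations_of_set (S - A). \<Sum>v\<in>permutations_of_set (B - S).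
        flag_monom z D' A (u @ v) / diff_prod z (u @ v)
        + (flag_monom z D' A u / diff_prod z u) * (flag_monom z D S v / diff_prod z v))
      + (\<Sum>w\<in>?P - ?T. flag_monom z D' A w / diff_prod z w)"
    unfolding order_sum_def split using through other by simp
  also have "\<dots> = order_sum z D' A B + order_sum z D' A S * order_sum z D S B"
    unfolding order_sum_def split sum_product by (simp add: sum.distrib)
  finally show ?thesis
    by (simp add: D'_def)
qed

text \<open>Lexicographic induction on \<open>card (B - A)\<close> and on the sum of the interior
  values of \<open>D\<close>. Lowering \<open>D\<close> at one set \<open>S\<close> can change
  either side only by a product over the two halves of the interval, by
  \<open>order_sum_step\<close> and \<open>chain_sum_insert\<close>. If all interior values equal
  \<open>D A\<close>, \<open>order_sum_const\<close> applies.\<close>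

lemma order_sum_eq_chain_sum:
  fixes z :: "'a \<Rightarrow> 'k::field"
  assumes "finite B" and "A \<subset> B" and "inj_on z (B - A)" and "mono_on {A..B} D"
    and "D B < D A + card (B - A)"
  shows "order_sum z D A B = (if Suc (D B) = D A + card (B - A)
    then (-1) ^ (card (B - A) - 1) * of_int (chain_sum {S \<in> Pow B. D A + card (S - A) \<le> D S} A B) else 0)"
  using assms
proof (induction "card (B - A)" arbitrary: A B D rule: less_induct)
  case (less A B)
  note outer = less.hyps and fin = less.prems(1) and AB = less.prems(2) and inj = less.prems(3)
  show ?case
    using less.prems(4,5)
  proof (induction "\<Sum>T\<in>{A<..<B}. D T" arbitrary: D rule: less_induct)
    case (less D)
    note mono = less.prems(1) and deg = less.prems(2)
    let ?X = "B - A"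
    have finI: "finite {A<..<B}"
      by (rule finite_subset[of _ "Pow B"]) (use fin in auto)
    have geA: "D A \<le> D T" if "A \<subseteq> T" "T \<subseteq> B" for T
      using that AB by (intro mono_onD[OF mono]) auto
    show ?case
    proof (cases "\<forall>T\<in>{A<..<B}. D T = D A")
      case True
      have "order_sum z D A B = lagrange_sum z (D B - D A) ?X"
        using True by (intro order_sum_const fin AB inj) simp
      also have "\<dots> = (if Suc (D B - D A) = card ?X then (-1) ^ (D B - D A) else 0)"
        using fin AB inj deg geA[of B] by (intro lagrange_sum_eq) auto
      finally have "order_sum z D A B = (if Suc (D B - D A) = card ?X then (-1) ^ (D B - D A) else 0)" .
      moreover have "chain_sum {S \<in> Pow B. D A + card (S - A) \<le> D S} A B = 1"
      proof -
        have "{S \<in> Pow B. D A + card (S - A) \<le> D S} \<inter> {A<..<B} = {}"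
        proof (rule equals0I)
          fix S assume "S \<in> {S \<in> Pow B. D A + card (S - A) \<le> D S} \<inter> {A<..<B}"
          then have S: "S \<subseteq> B" "D A + card (S - A) \<le> D S" "S \<in> {A<..<B}"
            by auto
          then have "finite (S - A)" "S - A \<noteq> {}"
            using fin by (auto intro: finite_subset)
          then have "card (S - A) > 0"
            by (simp add: card_gt_0_iff)
          then show False
            using S(2) True S(3) by auto
        qed
        then show ?thesis
          using chain_sum_rec[of "{S \<in> Pow B. D A + card (S - A) \<le> D S}" A B] fin by simp
      qed
      moreover have "Suc (D B - D A) = card ?X \<longleftrightarrow> Suc (D B) = D A + card ?X"
        using geA[of B] AB by auto
      moreover have "D B - D A = card ?X - 1" if "Suc (D B) = D A + card ?X"
        using that by linarith
      ultimately show ?thesis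
        by simp
    next
      case False
      then obtain S0 where S0: "S0 \<in> {A<..<B}" "D A < D S0"
        using geA by (metis (no_types, lifting) greaterThanLessThan_iff le_neq_implies_less psubset_imp_subset)
      \<comment> \<open>A minimal \<open>S\<close> in \<open>G\<close> has only sets of value
        \<open>D A\<close> strictly below it, so lowering \<open>D\<close> at \<open>S\<close> keeps
        it monotone and \<open>order_sum_step\<close> applies.\<close>
      define G where "G = {T \<in> {A<..<B}. D A < D T}"
      have "finite G"
        unfolding G_def using finI by (rule rev_finite_subset) blast
      moreover have "G \<noteq> {}"
        using S0 unfolding G_def by blast
      ultimately obtain S where S: "S \<in> G" and minS: "\<And>T. T \<in> G \<Longrightarrow> T \<subseteq> S \<Longrightarrow> T = S"
        using finite_has_minimal[of G] by blast
      have AS: "A \<subset> S" and SB: "S \<subset> B" and DS: "D A < D S"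
        using S by (auto simp: G_def)
      have below: "D T = D A" if "A \<subseteq> T" "T \<subset> S" for T
      proof (rule ccontr)
        assume "D T \<noteq> D A"
        moreover from this have "T \<noteq> A"
          by blast
        moreover have "D A \<le> D T"
          using that SB by (intro geA) auto
        ultimately have "T \<in> G"
          using that SB by (auto simp: G_def)
        then show False
          using minS[of T] that by auto
      qed
      define D' where "D' = D(S := D S - 1)"
      have D'S: "D' S = D S - 1" and D'_other: "\<And>T. T \<noteq> S \<Longrightarrow> D' T = D T"
        by (auto simp: D'_def)
      have D'A: "D' A = D A" and D'B: "D' B = D B"
        using AS SB by (auto simp: D'_def)
      have mono': "mono_on {A..B} D'"
      proof (rule mono_onI)
        fix T U assume TU: "T \<in> {A..B}" "U \<in> {A..B}" "T \<subseteq> U"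
        have le: "D T \<le> D U"
          using TU by (intro mono_onD[OF mono])
        show "D' T \<le> D' U"
        proof (cases "U = S \<and> T \<noteq> S")
          case True
          then have "D T = D A"
            using below[of T] TU by auto
          then show ?thesis
            using True DS by (simp add: D'S D'_other)
        next
          case False
          then show ?thesis
            using le by (auto simp: D'_def)
        qed
      qed
      have fS: "finite S"
        using SB fin by (auto intro: finite_subset)
      have card: "card ?X = card (S - A) + card (B - S)"
        using AS SB fin fS by (subst card_Un_disjoint[symmetric]) (auto intro!: arg_cong[where f = card])
      have cpos: "card (S - A) > 0" "card (B - S) > 0"
        using AS SB fin fS by (auto simp: card_gt_0_iff)
      define Q where "Q = {T \<in> Pow B. D A + card (T - A) \<le> D T}"
      define Q' where "Q' = {T \<in> Pow B. D A + card (T - A) \<le> D' T}"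
      have finQ': "finite Q'"
        using fin by (simp add: Q'_def)
      have step: "order_sum z D A B = order_sum z D' A B + order_sum z D' A S * order_sum z D S B"
        unfolding D'_def using fin AS SB inj mono
      proof (rule order_sum_step)
        fix T assume "A \<subseteq> T" "T \<subset> S"
        then show "D T < D S"
          using below[of T] DS by simp
      qed
      have inner: "order_sum z D' A B = (if Suc (D B) = D A + card ?X
          then (-1) ^ (card ?X - 1) * of_int (chain_sum Q' A B) else 0)"
      proof -
        have "(\<Sum>T\<in>{A<..<B}. D' T) < (\<Sum>T\<in>{A<..<B}. D T)"
          using finI AS SB DS by (intro sum_strict_mono_ex1) (auto simp: D'_def)
        then show ?thesis
          using less.hyps[of D'] mono' deg unfolding D'A D'B Q'_def by simp
      qed
      \<comment> \<open>The value at the top is now \<open>D S - 1\<close>, so the degree condition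
        of the formula becomes \<open>D S = D A + card (S - A)\<close>.\<close>
      have lower: "order_sum z D' A S = (if D S = D A + card (S - A)
          then (-1) ^ (card (S - A) - 1) * of_int (chain_sum Q' A S) else 0)"
        if "D S \<le> D A + card (S - A)"
      proof -
        have "chain_sum {T \<in> Pow S. D' A + card (T - A) \<le> D' T} A S = chain_sum Q' A S"
          by (rule chain_sum_cong) (use SB in \<open>auto simp: Q'_def D'A\<close>)
        moreover have "mono_on {A..S} D'"
          by (rule mono_on_subset[OF mono']) (use SB in auto)
        moreover have "inj_on z (S - A)"
          by (rule inj_on_subset[OF inj]) (use SB in auto)
        ultimately show ?thesis
          using outer[of S A D'] that fS AS card cpos DS by (simp add: D'A D'S)
      qed
      have upper: "order_sum z D S B = (if Suc (D B) = D S + card (B - S)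
          then (-1) ^ (card (B - S) - 1) * of_int (chain_sum {T \<in> Pow B. D S + card (T - S) \<le> D T} S B) else 0)"
        if "D B < D S + card (B - S)"
      proof -
        have "mono_on {S..B} D"
          by (rule mono_on_subset[OF mono]) (use AS in auto)
        moreover have "inj_on z (B - S)"
          by (rule inj_on_subset[OF inj]) (use AS in auto)
        ultimately show ?thesis
          using outer[of B S D] that fin SB card cpos by simp
      qed
      \<comment> \<open>In \<open>below\<close> the lower factor vanishes, in \<open>above\<close>
        the upper one, and \<open>S\<close> is admissible for both functions or for neither. In
        \<open>small\<close> the value at \<open>B\<close> is too low for the whole interval and for
        the upper half. Only in \<open>eq\<close> does a product survive, and there \<open>S\<close>
        ceases to be admissible.\<close>
      consider (below) "D S < D A + card (S - A)" | (above) "D S > D A + card (S - A)"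
        | (small) "D S = D A + card (S - A)" "Suc (D B) \<noteq> D A + card ?X"
        | (eq) "D S = D A + card (S - A)" "Suc (D B) = D A + card ?X"
        by linarith
      then show ?thesis
      proof cases
        case below
        then have "Q = Q'"
          by (auto simp: Q_def Q'_def D'_def split: if_splits)
        then show ?thesis
          using step inner lower below by (simp add: Q_def)
      next
        case above
        then have "Q = Q'"
          by (auto simp: Q_def Q'_def D'_def split: if_splits)
        then show ?thesis
          using step inner upper above deg card by (simp add: Q_def)
      next
        case small
        then show ?thesis
          using step inner upper deg card by simp
      next
        case eq
        have QQ': "Q = insert S Q'" "S \<notin> Q'"
          using eq SB DS by (auto simp: Q_def Q'_def D'_def split: if_splits)
        \<comment> \<open>By \<open>eq\<close> the threshold counted from \<open>S\<close> is the
          threshold counted from \<open>A\<close>.\<close>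
        have up: "chain_sum {T \<in> Pow B. D S + card (T - S) \<le> D T} S B = chain_sum Q' S B"
        proof (rule chain_sum_cong)
          fix T assume T: "S \<subset> T" "T \<subset> B"
          have "finite T"
            using T fin by (auto intro: finite_subset)
          then have "card (T - A) = card (S - A) + card (T - S)"
            using T AS fS by (subst card_Un_disjoint[symmetric]) (auto intro!: arg_cong[where f = card])
          then show "T \<in> {T \<in> Pow B. D S + card (T - S) \<le> D T} \<longleftrightarrow> T \<in> Q'"
            using T eq by (auto simp: Q'_def D'_def)
        qed
        have ins: "chain_sum Q A B = chain_sum Q' A B - chain_sum Q' A S * chain_sum Q' S B"
          unfolding QQ'(1) by (rule chain_sum_insert[OF finQ' QQ'(2) AS SB])
        obtain a where a: "card (S - A) = Suc a"
          using cpos gr0_implies_Suc by blast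
        obtain b where b: "card (B - S) = Suc b"
          using cpos gr0_implies_Suc by blast
        have "order_sum z D A S' = order_sum z D A S'" for S' ..
        have "order_sum z D S B = (-1) ^ b * of_int (chain_sum Q' S B)"
          using upper eq card b unfolding up by simp
        \<comment> \<open>The product carries one sign less than the whole (\<open>a + b\<close>
          against \<open>a + b + 1\<close>), which yields the minus sign of
          \<open>chain_sum_insert\<close>.\<close>
        then have "order_sum z D A B = (-1) ^ (a + b + 1) * of_int (chain_sum Q' A B)
            + ((-1) ^ a * of_int (chain_sum Q' A S)) * ((-1) ^ b * of_int (chain_sum Q' S B))"
          using step inner lower eq card a b by simp
        also have "\<dots> = (-1) ^ (a + b + 1) * of_int (chain_sum Q A B)"
          unfolding ins by (simp add: power_add algebra_simps)
        finally show ?thesis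
          using eq card a b by (simp add: Q_def)
      qed
    qed
  qed
qed

section \<open>Elementary symmetric polynomials and lattice paths\<close>

lemma elem_sym_0 [simp]: "finite A \<Longrightarrow> elem_sym 0 A u = 1"
proof -
  assume "finite A"
  then have "{T. T \<subseteq> A \<and> card T = 0} = {{}}"
    by (auto dest: finite_subset)
  then show ?thesis
    by (simp add: elem_sym_def)
qed

lemma elem_sym_card:
  assumes "finite A"
  shows "elem_sym (card A) A u = (\<Prod>e\<in>A. u e)"
proof -
  have "{T. T \<subseteq> A \<and> card T = card A} = {A}"
    using card_subset_eq[OF assms] by auto
  then show ?thesis
    by (simp add: elem_sym_def)
qed

lemma elem_sym_insert:
  assumes "finite A" and "c \<notin> A"
  shows "elem_sym (Suc k) (insert c A) u = elem_sym (Suc k) A u + u c * elem_sym k A u"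
proof -
  let ?S = "\<lambda>k. {T. T \<subseteq> A \<and> card T = k}"
  have fin: "finite (?S k)" for k
    using assms(1) by (auto intro: finite_subset[of _ "Pow A"])
  have finT: "finite T" "c \<notin> T" if "T \<in> ?S k" for T k
    using that assms by (auto intro: finite_subset)
  have "{T. T \<subseteq> insert c A \<and> card T = Suc k} = ?S (Suc k) \<union> insert c ` ?S k"
  proof (intro set_eqI iffI)
    fix T assume T: "T \<in> {T. T \<subseteq> insert c A \<and> card T = Suc k}"
    show "T \<in> ?S (Suc k) \<union> insert c ` ?S k"
    proof (cases "c \<in> T")
      case True
      then have "T = insert c (T - {c})" "T - {c} \<in> ?S k"
        using T by auto
      then show ?thesis
        by blast
    next
      case False
      then show ?thesis
        using T by auto
    qed
  next
    fix T assume "T \<in> ?S (Suc k) \<union> insert c ` ?S k"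
    then consider "T \<in> ?S (Suc k)" | U where "U \<in> ?S k" "T = insert c U"
      by blast
    then show "T \<in> {T. T \<subseteq> insert c A \<and> card T = Suc k}"
    proof cases
      case 2
      then show ?thesis
        using finT[of U k] by auto
    qed auto
  qed
  moreover have "?S (Suc k) \<inter> insert c ` ?S k = {}"
    using assms(2) by auto
  moreover have "inj_on (insert c) (?S k)"
    using finT(2) by (intro inj_onI) (metis Diff_insert_absorb)
  ultimately have "elem_sym (Suc k) (insert c A) u
      = elem_sym (Suc k) A u + (\<Sum>T\<in>?S k. \<Prod>e\<in>insert c T. u e)"
    unfolding elem_sym_def using fin by (simp add: sum.union_disjoint sum.reindex)
  also have "(\<Sum>T\<in>?S k. \<Prod>e\<in>insert c T. u e) = u c * elem_sym k A u"
    unfolding elem_sym_def sum_distrib_left using finT by (intro sum.cong refl prod.insert)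
  finally show ?thesis .
qed

text \<open>Multiplying the generating function \<open>\<Prod>e\<in>A. 1 + u e * t\<close> by \<open>1 / (1 + u x * t)\<close> deletes the factor of \<open>x\<close>.\<close>

lemma elem_sym_remove:
  assumes fin: "finite A" and x: "x \<in> A"
  shows "(\<Sum>j\<le>k. (- u x) ^ j * elem_sym (k - j) A u) = elem_sym k (A - {x}) u"
proof (induction k)
  case (Suc k)
  have "(\<Sum>j\<le>Suc k. (- u x) ^ j * elem_sym (Suc k - j) A u)
      = elem_sym (Suc k) A u - u x * (\<Sum>j\<le>k. (- u x) ^ j * elem_sym (k - j) A u)"
    by (simp add: sum.atMost_Suc_shift sum_distrib_left mult.assoc sum_negf del: sum.atMost_Suc)
  also have "\<dots> = elem_sym (Suc k) (A - {x}) u"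
    using elem_sym_insert[of "A - {x}" x k u] fin x by (simp add: Suc.IH insert_absorb)
  finally show ?case .
qed (use fin in simp)

section \<open>Lattice paths as lists of steps\<close>

definition ups :: "(int \<times> int) list \<Rightarrow> nat"
  where "ups s = length (filter (\<lambda>d. d = (1, 1)) s)"

definition step_lists :: "nat \<Rightarrow> nat \<Rightarrow> (int \<times> int) list set"
  where "step_lists l k = {s. set s \<subseteq> {(1, 1), (1, 0)} \<and> length s = l \<and> ups s = k}"

text \<open>The up steps of the path select entries of the list, and the product runs over these;
  where one list is longer, its excess is ignored.\<close>

fun path_monom :: "('a \<Rightarrow> 'c::comm_ring_1) \<Rightarrow> 'a list \<Rightarrow> (int \<times> int) list \<Rightarrow> 'c" where
  "path_monom u (c # cs) (d # s) = (if d = (1, 1) then u c else 1) * path_monom u cs s"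
| "path_monom u _ _ = 1"

lemma finite_step_lists: "finite (step_lists l k)"
  by (rule finite_subset[OF _ finite_lists_length_eq[of "{(1, 1), (1, 0)}" l]]) (auto simp: step_lists_def)

lemma step_lists_0: "step_lists 0 k = (if k = 0 then {[]} else {})"
  by (auto simp: step_lists_def ups_def)

lemma step_lists_Suc:
  "step_lists (Suc l) k = (#) (1, 0) ` step_lists l k \<union> (if k = 0 then {} else (#) (1, 1) ` step_lists l (k - 1))"
proof (intro set_eqI iffI)
  fix s assume "s \<in> step_lists (Suc l) k"
  then show "s \<in> (#) (1, 0) ` step_lists l k \<union> (if k = 0 then {} else (#) (1, 1) ` step_lists l (k - 1))"
    by (cases s) (auto simp: step_lists_def ups_def)
qed (auto simp: step_lists_def ups_def split: if_splits)

text \<open>Subsets of size \<open>k\<close> correspond to paths with \<open>k\<close> up steps;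
  both sides obey the Pascal recursion at the first entry.\<close>

lemma elem_sym_conv_paths:
  assumes "distinct cs"
  shows "elem_sym k (set cs) u = (\<Sum>s\<in>step_lists (length cs) k. path_monom u cs s)"
  using assms
proof (induction cs arbitrary: k)
  case Nil
  have "elem_sym k {} u = (if k = 0 then 1 else 0)"
  proof (cases "k = 0")
    case False
    then have none: "{T :: 'a set. T \<subseteq> {} \<and> card T = k} = {}"
      by auto
    show ?thesis
      using False unfolding elem_sym_def none by simp
  qed simp
  then show ?case
    by (simp add: step_lists_0)
next
  case (Cons c cs)
  show ?case
  proof (cases k)
    case 0
    then show ?thesis
      using Cons.IH[of 0] Cons.prems by (simp add: step_lists_Suc sum.reindex)
  next
    case (Suc k')
    have "(#) (1, 0) ` step_lists (length cs) k \<inter> (#) (1, 1) ` step_lists (length cs) k' = {}"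
      by auto
    then have "(\<Sum>s\<in>step_lists (length (c # cs)) k. path_monom u (c # cs) s)
        = (\<Sum>s\<in>step_lists (length cs) k. path_monom u cs s) + u c * (\<Sum>s\<in>step_lists (length cs) k'. path_monom u cs s)"
      by (simp add: step_lists_Suc Suc sum.union_disjoint finite_step_lists sum.reindex sum_distrib_left)
    then show ?thesis
      using Cons elem_sym_insert[of "set cs" c k' u] by (simp add: Suc)
  qed
qed

lemma path_monom_snoc:
  "path_monom u (cs @ [c]) s
    = path_monom u cs s * (if length cs < length s \<and> s ! length cs = (1, 1) then u c else 1)"
proof (induction cs arbitrary: s)
  case Nil
  show ?case
    by (cases s) auto
next
  case (Cons d cs)
  then show ?case
    by (cases s) auto
qed

lemma ups_take_Suc:
  "ups (take (Suc a) s) = ups (take a s) + (if a < length s \<and> s ! a = (1, 1) then 1 else 0)"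
  by (cases "a < length s") (auto simp: take_Suc_conv_app_nth ups_def)

lemma ups_take_mono: "a \<le> b \<Longrightarrow> ups (take a s) \<le> ups (take b s)"
  by (induction b rule: dec_induct) (auto simp: ups_take_Suc)

lemma ups_take_le: "ups (take a s) \<le> ups s"
  using ups_take_mono[of a "max a (length s)" s] by simp

lemma sum_list_steps:
  assumes "set s \<subseteq> {(1, 1), (1, 0)}"
  shows "sum_list s = (int (length s), int (ups s))"
  using assms by (induction s) (auto simp: ups_def zero_prod_def)

lemma weakly_above_iff: "weakly_above s (int a, int b) \<longleftrightarrow> b \<le> ups (take a s)"
proof -
  have "take (nat (min (int a) (int (length s)))) s = take a s"
    by (cases "a \<le> length s") auto
  then show ?thesis
    by (simp add: weakly_above_def ups_def)
qed

section \<open>Matroids\<close>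

context matroid
begin

lemma finite_indep_subsets: "finite {I. I \<subseteq> S \<and> indep I}"
  by (rule finite_subset[of _ "Pow E"]) (auto dest: indep_subset_ground simp: finite_ground)

lemma indep_finite: "indep I \<Longrightarrow> finite I"
  using indep_subset_ground finite_ground finite_subset by blast

lemma card_le_rank: "indep I \<Longrightarrow> I \<subseteq> S \<Longrightarrow> card I \<le> rank S"
  unfolding rank_def using finite_indep_subsets by (intro Max_ge) auto

lemma rank_witness: obtains I where "indep I" "I \<subseteq> S" "card I = rank S"
proof -
  have "rank S \<in> card ` {I. I \<subseteq> S \<and> indep I}"
    unfolding rank_def using finite_indep_subsets indep_empty by (intro Max_in) auto
  then show ?thesis
    using that by auto
qed

lemma rank_mono: "S \<subseteq> T \<Longrightarrow> rank S \<le> rank T"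
  by (metis rank_witness card_le_rank order.trans)

lemma rank_le_card: "finite S \<Longrightarrow> rank S \<le> card S"
  by (metis rank_witness card_mono)

lemma rank_insert_le: "rank (insert e S) \<le> Suc (rank S)"
proof -
  obtain I where I: "indep I" "I \<subseteq> insert e S" "card I = rank (insert e S)"
    by (rule rank_witness)
  have "card (I - {e}) \<le> rank S"
    using I by (intro card_le_rank indep_subset[OF I(1)]) auto
  moreover have "card I \<le> Suc (card (I - {e}))"
    by (metis card_Diff1_le card_Suc_Diff1 diff_le_self Diff_empty Diff_insert0 I(1) indep_finite le_SucI le_refl)
  ultimately show ?thesis
    using I(3) by simp
qed

lemma rank_Un_le: "finite X \<Longrightarrow> rank (S \<union> X) \<le> rank S + card X"
proof (induction X rule: finite_induct)
  case (insert x X)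
  then show ?case
    using rank_insert_le[of x "S \<union> X"] by simp
qed simp

text \<open>Each element raises the rank by at most one. The nullity is the abscissa of
  \<open>rank_point\<close>, so it says how many steps of a path are inspected.\<close>

lemma nullity_mono:
  assumes "S \<subseteq> T" and "finite T"
  shows "card S - rank S \<le> card T - rank T"
proof -
  have fin: "finite S"
    using assms finite_subset by blast
  have "rank T \<le> rank S + card (T - S)"
    using rank_Un_le[of "T - S" S] assms by (simp add: Un_absorb1)
  moreover have "card T = card S + card (T - S)"
    using assms fin by (metis card_Un_disjoint Diff_disjoint Un_Diff_cancel Un_absorb1 finite_Diff)
  moreover have "rank S \<le> card S"
    using fin by (rule rank_le_card)
  ultimately show ?thesis
    by linarith
qed

lemma indep_extend:
  assumes I: "indep I" "I \<subseteq> T"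
  obtains J where "indep J" "I \<subseteq> J" "J \<subseteq> T" "card J = rank T"
proof -
  define G where "G = {J. J \<subseteq> T \<and> indep J \<and> I \<subseteq> J}"
  have "finite G"
    unfolding G_def by (rule finite_subset[OF _ finite_indep_subsets[of T]]) auto
  moreover have "I \<in> G"
    using I by (simp add: G_def)
  ultimately obtain J where "J \<in> G" and max: "\<And>K. K \<in> G \<Longrightarrow> J \<subseteq> K \<Longrightarrow> J = K"
    using finite_has_maximal[of G] by blast
  then have J: "indep J" "I \<subseteq> J" "J \<subseteq> T"
    by (simp_all add: G_def)
  obtain K where K: "indep K" "K \<subseteq> T" "card K = rank T"
    by (rule rank_witness)
  have "\<not> card J < card K"
  proof
    assume "card J < card K"
    then obtain e where e: "e \<in> K - J" "indep (insert e J)"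
      using augmentation J(1) K(1) by blast
    then have "insert e J \<in> G"
      using J K(2) by (auto simp: G_def)
    then show False
      using max[of "insert e J"] e by blast
  qed
  moreover have "card J \<le> rank T"
    using J(1,3) by (rule card_le_rank)
  ultimately have "card J = rank T"
    using K(3) by simp
  then show ?thesis
    by (rule that[OF J])
qed

text \<open>If \<open>e\<close> raised the rank of \<open>T\<close>, it would augment a maximal
  independent subset of \<open>T\<close> that extends one of \<open>S\<close>, and so raise the rank
  of \<open>S\<close> as well.\<close>

lemma rank_insert_eq_mono:
  assumes "S \<subseteq> T" and "rank (insert e S) = rank S"
  shows "rank (insert e T) = rank T"
proof (rule antisym)
  show "rank T \<le> rank (insert e T)"
    by (rule rank_mono) auto
  show "rank (insert e T) \<le> rank T"
  proof (rule ccontr)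
    assume "\<not> rank (insert e T) \<le> rank T"
    moreover obtain I where I: "indep I" "I \<subseteq> S" "card I = rank S"
      by (rule rank_witness)
    moreover obtain J where J: "indep J" "I \<subseteq> J" "J \<subseteq> T" "card J = rank T"
      using indep_extend[of I T] I assms(1) by blast
    moreover obtain K where K: "indep K" "K \<subseteq> insert e T" "card K = rank (insert e T)"
      by (rule rank_witness)
    ultimately obtain x where x: "x \<in> K - J" "indep (insert x J)"
      using augmentation[of J K] by auto
    have fJ: "finite J"
      using J(1) by (rule indep_finite)
    have "x \<notin> T"
    proof
      assume "x \<in> T"
      then have "card (insert x J) \<le> rank T"
        using x J by (intro card_le_rank) auto
      then show False
        using x J fJ by simp
    qed
    then have "x = e"
      using x K by auto
    then have "indep (insert e I)" "e \<notin> I"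
      using x J indep_subset[of "insert e J" "insert e I"] by auto
    then have "Suc (card I) \<le> rank (insert e S)"
      using card_le_rank[of "insert e I" "insert e S"] I indep_finite[OF I(1)] by auto
    then show False
      using I(3) assms(2) by simp
  qed
qed

lemma rank_Un_eq:
  assumes "finite X" and "\<And>e. e \<in> X \<Longrightarrow> rank (insert e S) = rank S"
  shows "rank (S \<union> X) = rank S"
  using assms
proof (induction X rule: finite_induct)
  case (insert x X)
  then show ?case
    using rank_insert_eq_mono[of S "S \<union> X" x] by simp
qed simp

section \<open>Closure\<close>

lemma closure_subset: "closure S \<subseteq> E"
  by (auto simp: closure_def)

lemma subset_closure: "S \<subseteq> E \<Longrightarrow> S \<subseteq> closure S"
  by (auto simp: closure_def insert_absorb)

lemma closure_mono: "S \<subseteq> T \<Longrightarrow> closure S \<subseteq> closure T"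
  using rank_insert_eq_mono by (auto simp: closure_def)

lemma rank_closure:
  assumes "S \<subseteq> E"
  shows "rank (closure S) = rank S"
proof -
  have "rank (S \<union> closure S) = rank S"
    by (rule rank_Un_eq) (use closure_subset finite_ground in \<open>auto intro: finite_subset simp: closure_def\<close>)
  then show ?thesis
    using subset_closure[OF assms] by (simp add: Un_absorb1)
qed

lemma closure_closure:
  assumes "S \<subseteq> E"
  shows "closure (closure S) = closure S"
proof
  show "closure (closure S) \<subseteq> closure S"
  proof
    fix e assume e: "e \<in> closure (closure S)"
    then have "rank (insert e (closure S)) = rank S"
      using rank_closure[OF assms] by (simp add: closure_def)
    moreover have "rank (insert e S) \<le> rank (insert e (closure S))"
      using subset_closure[OF assms] by (intro rank_mono) auto
    moreover have "rank S \<le> rank (insert e S)"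
      by (rule rank_mono) auto
    ultimately show "e \<in> closure S"
      using e by (simp add: closure_def)
  qed
qed (rule subset_closure[OF closure_subset])

section \<open>Loops, coloops and bases\<close>

lemma rank_empty [simp]: "rank {} = 0"
  using rank_le_card[of "{}"] by simp

lemma rank_singleton: "e \<in> E \<Longrightarrow> \<not> loop e \<Longrightarrow> rank {e} = 1"
  using card_le_rank[of "{e}" "{e}"] rank_le_card[of "{e}"] by (simp add: loop_def)

lemma rank_loop:
  assumes "loop e"
  shows "rank (insert e S) = rank S"
proof -
  have "rank {e} = 0"
  proof -
    obtain I where "indep I" "I \<subseteq> {e}" "card I = rank {e}"
      by (rule rank_witness)
    then show ?thesis
      using assms by (auto simp: loop_def subset_singleton_iff)
  qed
  then show ?thesis
    using rank_insert_eq_mono[of "{}" S e] by simp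
qed

lemma closure_empty:
  assumes "\<nexists>e. loop e"
  shows "closure {} = {}"
  using rank_singleton assms by (auto simp: closure_def)

lemma basis_iff: "basis B \<longleftrightarrow> indep B \<and> card B = rank E"
proof
  assume B: "basis B"
  then have iB: "indep B"
    by (simp add: basis_def)
  obtain J where J: "indep J" "B \<subseteq> J" "J \<subseteq> E" "card J = rank E"
    using indep_extend[OF iB indep_subset_ground[OF iB]] by blast
  have "J = B"
  proof (rule ccontr)
    assume "J \<noteq> B"
    then obtain e where "e \<in> J - B"
      using J by blast
    then have "indep (insert e B)" "e \<in> E - B"
      using J indep_subset[of J "insert e B"] by auto
    then show False
      using B by (auto simp: basis_def)
  qed
  then show "indep B \<and> card B = rank E"
    using J by simp
next
  assume B: "indep B \<and> card B = rank E"
  have "\<not> indep (insert e B)" if "e \<in> E - B" for e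
  proof
    assume i: "indep (insert e B)"
    then have "card (insert e B) \<le> rank E"
      using indep_subset_ground by (intro card_le_rank) auto
    then show False
      using B that indep_finite[of B] by simp
  qed
  then show "basis B"
    using B by (simp add: basis_def)
qed

text \<open>A maximal independent subset of \<open>S - {e}\<close> extends to a basis of the
  matroid, which contains \<open>e\<close>.\<close>

lemma rank_coloop:
  assumes e: "coloop e" "e \<in> S" and S: "S \<subseteq> E"
  shows "rank S = Suc (rank (S - {e}))"
proof (rule antisym)
  show "rank S \<le> Suc (rank (S - {e}))"
    using rank_insert_le[of e "S - {e}"] e by (simp add: insert_absorb)
  obtain I where I: "indep I" "I \<subseteq> S - {e}" "card I = rank (S - {e})"
    by (rule rank_witness)
  obtain J where J: "indep J" "I \<subseteq> J" "J \<subseteq> E" "card J = rank E"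
    using indep_extend[OF I(1) indep_subset_ground[OF I(1)]] by blast
  have "e \<in> J"
    using J e(1) by (auto simp: basis_iff coloop_def)
  then have "indep (insert e I)" "e \<notin> I"
    using J I indep_subset[of J "insert e I"] by auto
  then show "Suc (rank (S - {e})) \<le> rank S"
    using card_le_rank[of "insert e I" S] I e(2) indep_finite[OF I(1)] by auto
qed

lemma rank_diff_non_coloop:
  assumes "e \<in> E" and "\<not> coloop e"
  shows "rank (E - {e}) = rank E"
proof (rule antisym)
  show "rank (E - {e}) \<le> rank E"
    by (rule rank_mono) auto
  obtain B where B: "basis B" "e \<notin> B"
    using assms by (auto simp: coloop_def)
  then have "indep B" "card B = rank E"
    by (simp_all add: basis_iff)
  then show "rank E \<le> rank (E - {e})"
    using card_le_rank[of B "E - {e}"] B(2) indep_subset_ground[of B] by auto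
qed

text \<open>A non-loop has rank 1, and deleting a non-coloop keeps the rank. The bounds make n - r -
  1 and r - 1 genuine differences.\<close>

lemma rank_ground_bounds:
  assumes "E \<noteq> {}" and "\<nexists>e. loop e \<or> coloop e"
  shows "0 < rank E" and "rank E < card E"
proof -
  obtain e where e: "e \<in> E"
    using assms(1) by blast
  have "rank {e} \<le> rank E"
    using e by (intro rank_mono) auto
  then show "0 < rank E"
    using rank_singleton[OF e] assms(2) by simp
  have "rank (E - {e}) \<le> card (E - {e})"
    using finite_ground by (intro rank_le_card) auto
  moreover have "card (E - {e}) < card E"
    using finite_ground e by (rule card_Diff1_less)
  ultimately show "rank E < card E"
    using rank_diff_non_coloop[OF e] assms(2) by simp
qed

end

section \<open>The $g$-polynomial and chains of sets\<close>

lemma to_fract_sum: "to_fract (\<Sum>x\<in>A. f x) = (\<Sum>x\<in>A. to_fract (f x))"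
  by (induction A rule: infinite_finite_induct) auto

lemma to_fract_power: "to_fract (a ^ m) = to_fract a ^ m"
  by (induction m) auto

lemma to_fract_flag_monom: "to_fract (flag_monom z D A w) = flag_monom (\<lambda>e. to_fract (z e)) D A w"
  by (induction w arbitrary: A) (auto simp: to_fract_power)

lemma to_fract_diff_prod: "to_fract (diff_prod z w) = diff_prod (\<lambda>e. to_fract (z e)) w"
  by (induction z w rule: diff_prod.induct) auto

text \<open>Through \<open>diff_prod_nonzero\<close> this keeps the denominators of the order sums
  nonzero.\<close>

lemma Var_eq_iff: "Var a = Var b \<longleftrightarrow> a = b"
proof
  assume "Var a = Var b"
  then have "Poly_Mapping.single (Poly_Mapping.single a (1 :: nat)) (1 :: int) = Poly_Mapping.single (Poly_Mapping.single b 1) 1"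
    by transfer
  then have "Poly_Mapping.keys (Poly_Mapping.single (Poly_Mapping.single a (1 :: nat)) (1 :: int))
      = Poly_Mapping.keys (Poly_Mapping.single (Poly_Mapping.single b (1 :: nat)) (1 :: int))"
    by (rule arg_cong)
  then have "Poly_Mapping.single a (1 :: nat) = Poly_Mapping.single b 1"
    by simp
  then have "Poly_Mapping.keys (Poly_Mapping.single a (1 :: nat)) = Poly_Mapping.keys (Poly_Mapping.single b (1 :: nat))"
    by (rule arg_cong)
  then show "a = b"
    by simp
qed simp

text \<open>Exchanging the sums over chains and over paths leaves, for each path, the signed chains
  of sets whose points it passes weakly above.\<close>

lemma sum_chains_between:
  fixes pt :: "'a set \<Rightarrow> int \<times> int"
  assumes fin: "finite \<S>" and AB: "A \<in> \<S>" "B \<in> \<S>" "A \<subset> B" and finP: "finite P"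
  shows "(\<Sum>C\<in>chains_between \<S> A B. let k = length C - 1 in (-1) ^ (k - 1) *
      int (card {s \<in> P. \<forall>i\<in>{1..<k}. weakly_above s (pt (C ! i))}))
    = (\<Sum>s\<in>P. chain_sum {S \<in> \<S>. weakly_above s (pt S)} A B)"
proof -
  let ?Ch = "{I. set I \<subseteq> \<S> \<inter> {A<..<B} \<and> sorted_wrt (\<subset>) I}"
  have eq: "chains_between \<S> A B = (\<lambda>I. A # I @ [B]) ` ?Ch"
  proof (intro set_eqI iffI)
    fix C assume "C \<in> chains_between \<S> A B"
    then have C: "C \<noteq> []" "set C \<subseteq> \<S>" "sorted_wrt (\<subset>) C" "hd C = A" "last C = B"
      by (simp_all add: chains_between_def)
    obtain D where D: "C = A # D"
      using C(1,4) by (cases C) auto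
    have "D \<noteq> []"
      using C(5) AB(3) D by auto
    then obtain I where I: "D = I @ [B]"
      using C(5) D by (metis append_butlast_last_id last_ConsR)
    have "I \<in> ?Ch"
      using C(2,3) unfolding D I by (auto simp: sorted_wrt_append)
    then show "C \<in> (\<lambda>I. A # I @ [B]) ` ?Ch"
      using D I by blast
  next
    fix C assume "C \<in> (\<lambda>I. A # I @ [B]) ` ?Ch"
    then obtain I where I: "C = A # I @ [B]" "set I \<subseteq> \<S>" "set I \<subseteq> {A<..<B}" "sorted_wrt (\<subset>) I"
      by auto
    have "A \<subset> S \<and> S \<subset> B" if "S \<in> set I" for S
      using subsetD[OF I(3) that] by simp
    then show "C \<in> chains_between \<S> A B"
      using I(1,2,4) AB by (simp add: chains_between_def sorted_wrt_append ball_Un)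
  qed
  have finCh: "finite ?Ch"
    using fin by (intro finite_sorted_wrt_less) auto
  \<comment> \<open>The indices from 1 to k - 1 of \<open>A # I @ [B]\<close> are exactly the
    positions of \<open>I\<close>.\<close>
  have interior: "(\<forall>i\<in>{1..<Suc (length I)}. weakly_above s (pt ((A # I @ [B]) ! i))) \<longleftrightarrow> set I \<subseteq> {S. weakly_above s (pt S)}" for s I
  proof -
    have "{1..<Suc (length I)} = Suc ` {..<length I}"
      by (simp add: lessThan_atLeast0)
    then have "(\<forall>i\<in>{1..<Suc (length I)}. weakly_above s (pt ((A # I @ [B]) ! i)))
        \<longleftrightarrow> (\<forall>j<length I. weakly_above s (pt (I ! j)))"
      by (auto simp: nth_append)
    also have "\<dots> \<longleftrightarrow> (\<forall>S\<in>set I. weakly_above s (pt S))"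
      by (simp only: all_set_conv_all_nth)
    finally show ?thesis
      by (simp only: subset_iff Ball_def mem_Collect_eq)
  qed
  have "(\<Sum>C\<in>chains_between \<S> A B. let k = length C - 1 in (-1) ^ (k - 1) *
      int (card {s \<in> P. \<forall>i\<in>{1..<k}. weakly_above s (pt (C ! i))}))
    = (\<Sum>I\<in>?Ch. (-1) ^ length I * int (card {s \<in> P. set I \<subseteq> {S. weakly_above s (pt S)}}))"
  proof -
    have "inj_on (\<lambda>I. A # I @ [B]) ?Ch"
      by (simp add: inj_on_def)
    moreover have "length (A # I @ [B]) - 1 = Suc (length I)" for I
      by simp
    ultimately show ?thesis
      unfolding eq by (simp only: sum.reindex o_def Let_def interior diff_Suc_1)
  qed
  also have "\<dots> = (\<Sum>I\<in>?Ch. \<Sum>s\<in>P. if set I \<subseteq> {S. weakly_above s (pt S)} then (-1) ^ length I else 0)"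
  proof (intro sum.cong refl)
    fix I
    have "(\<Sum>s\<in>P. if set I \<subseteq> {S. weakly_above s (pt S)} then (-1) ^ length I else 0)
        = (\<Sum>s\<in>{s \<in> P. set I \<subseteq> {S. weakly_above s (pt S)}}. (-1 :: int) ^ length I)"
      using finP by (rule sum.inter_filter[symmetric])
    then show "(-1) ^ length I * int (card {s \<in> P. set I \<subseteq> {S. weakly_above s (pt S)}})
        = (\<Sum>s\<in>P. if set I \<subseteq> {S. weakly_above s (pt S)} then (-1) ^ length I else 0)"
      by simp
  qed
  also have "\<dots> = (\<Sum>s\<in>P. \<Sum>I\<in>?Ch. if set I \<subseteq> {S. weakly_above s (pt S)} then (-1) ^ length I else 0)"
    by (rule sum.swap)
  also have "\<dots> = (\<Sum>s\<in>P. chain_sum {S \<in> \<S>. weakly_above s (pt S)} A B)"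
  proof (intro sum.cong refl)
    fix s
    have "{I \<in> ?Ch. set I \<subseteq> {S. weakly_above s (pt S)}}
        = {I. set I \<subseteq> {S \<in> \<S>. weakly_above s (pt S)} \<inter> {A<..<B} \<and> sorted_wrt (\<subset>) I}"
      by auto
    then show "(\<Sum>I\<in>?Ch. if set I \<subseteq> {S. weakly_above s (pt S)} then (-1) ^ length I else 0)
        = chain_sum {S \<in> \<S>. weakly_above s (pt S)} A B"
      unfolding chain_sum_def using finCh by (simp add: sum.inter_filter[symmetric])
  qed
  finally show ?thesis .
qed

section \<open>Greedy bases, levels of sets and Ferroni paths\<close>

context matroid
begin

lemma mem_greedy_basis_iff:
  assumes "distinct (u @ x # v)"
  shows "x \<in> greedy_basis (u @ x # v) \<longleftrightarrow> rank (set u) < rank (insert x (set u))"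
proof -
  let ?w = "u @ x # v"
  have idx: "?w ! k = x \<longleftrightarrow> k = length u" if "k < length ?w" for k
    using nth_eq_iff_index_eq[OF assms that, of "length u"] by simp
  have "x \<in> greedy_basis ?w \<longleftrightarrow> rank (set (take (Suc (length u)) ?w)) > rank (set (take (length u) ?w))"
  proof
    assume "x \<in> greedy_basis ?w"
    then obtain k where "x = ?w ! k" "k < length ?w" "rank (set (take (Suc k) ?w)) > rank (set (take k ?w))"
      unfolding greedy_basis_def by blast
    then show "rank (set (take (Suc (length u)) ?w)) > rank (set (take (length u) ?w))"
      using idx by metis
  next
    assume "rank (set (take (Suc (length u)) ?w)) > rank (set (take (length u) ?w))"
    then show "x \<in> greedy_basis ?w"
      unfolding greedy_basis_def mem_Collect_eq by (intro exI[of _ "length u"]) simp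
  qed
  then show ?thesis
    by simp
qed

text \<open>Each element of a prefix raises either the rank, and is then in the greedy basis, or the
  nullity.\<close>

lemma length_filter_greedy_basis:
  assumes "distinct (u @ v)"
  shows "length (filter (\<lambda>c. c \<notin> greedy_basis (u @ v)) u) = card (set u) - rank (set u)"
  using assms
proof (induction u arbitrary: v rule: rev_induct)
  case (snoc x u)
  have IH: "length (filter (\<lambda>c. c \<notin> greedy_basis (u @ x # v)) u) = card (set u) - rank (set u)"
    using snoc.IH[of "x # v"] snoc.prems by simp
  have "rank (set u) \<le> card (set u)" "rank (set u) \<le> rank (insert x (set u))" "rank (insert x (set u)) \<le> Suc (rank (set u))"
    by (auto intro: rank_le_card rank_mono rank_insert_le)
  then show ?case
    using IH mem_greedy_basis_iff[of u x v] snoc.prems by auto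
qed simp

text \<open>The exponents of \<open>flag_monom\<close> for this function are 0 on the greedy basis, and 1 or 2 on its
  complement according to the steps of the path. Moreover \<open>S\<close> has level at least \<open>card S\<close> iff
  the path passes weakly above \<open>rank_point S\<close>.\<close>

definition path_level :: "(int \<times> int) list \<Rightarrow> 'a set \<Rightarrow> nat"
  where "path_level s S = (card S - rank S) + ups (take (card S - rank S) s)"

text \<open>The greedy basis refers to the whole ordering, so the induction is over prefixes
  \<open>u\<close> with the rest \<open>v\<close> arbitrary.\<close>

lemma flag_monom_path_level:
  assumes "distinct (u @ v)"
  defines "B \<equiv> greedy_basis (u @ v)"
  shows "flag_monom z (path_level s) {} u = (\<Prod>c\<in>set u - B. z c) * path_monom z (filter (\<lambda>c. c \<notin> B) u) s"
  using assms(1) unfolding B_def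
proof (induction u arbitrary: v rule: rev_induct)
  case Nil
  show ?case
    by (cases s) simp_all
next
  case (snoc x u)
  let ?B = "greedy_basis (u @ x # v)" and ?d = "card (set u) - rank (set u)"
  have IH: "flag_monom z (path_level s) {} u = (\<Prod>c\<in>set u - ?B. z c) * path_monom z (filter (\<lambda>c. c \<notin> ?B) u) s"
    using snoc.IH[of "x # v"] snoc.prems by simp
  have x: "x \<notin> set u"
    using snoc.prems by simp
  have len: "length (filter (\<lambda>c. c \<notin> ?B) u) = ?d"
    using length_filter_greedy_basis[of u "x # v"] snoc.prems by simp
  have rk: "rank (set u) \<le> card (set u)" "rank (set u) \<le> rank (insert x (set u))" "rank (insert x (set u)) \<le> Suc (rank (set u))"
    by (auto intro: rank_le_card rank_mono rank_insert_le)
  have mem: "x \<in> ?B \<longleftrightarrow> rank (set u) < rank (insert x (set u))"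
    using mem_greedy_basis_iff[of u x v] snoc.prems by simp
  show ?case
  proof (cases "x \<in> ?B")
    case True
    then have "rank (insert x (set u)) = Suc (rank (set u))"
      using rk mem by simp
    then have "path_level s (insert x (set u)) = path_level s (set u)"
      using x by (simp add: path_level_def)
    then show ?thesis
      using IH True by (simp add: flag_monom_append insert_Diff_if)
  next
    case False
    \<comment> \<open>One more step of \<open>s\<close> is read, at the index given by the previous
      nullity \<open>?d\<close>; beyond the end of \<open>s\<close> it counts as flat.\<close>
    then have "path_level s (insert x (set u)) - path_level s (set u) = (if ?d < length s \<and> s ! ?d = (1, 1) then 2 else 1)"
      using rk mem x by (simp add: path_level_def Suc_diff_le ups_take_Suc)
    then show ?thesis
      using IH False x by (simp add: flag_monom_append insert_Diff_if path_monom_snoc len power2_eq_square algebra_simps)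
  qed
qed

lemma mono_path_level: "mono_on {{}..E} (path_level s)"
proof (rule mono_onI)
  fix S T :: "'a set"
  assume "S \<in> {{}..E}" "T \<in> {{}..E}" "S \<le> T"
  then have "card S - rank S \<le> card T - rank T"
    using finite_ground by (intro nullity_mono) (auto intro: finite_subset)
  then show "path_level s S \<le> path_level s T"
    unfolding path_level_def by (intro add_mono ups_take_mono)
qed

lemma weakly_above_rank_point_iff:
  assumes "finite S"
  shows "weakly_above s (rank_point S) \<longleftrightarrow> rank S \<le> ups (take (card S - rank S) s)"
proof -
  have "rank_point S = (int (card S - rank S), int (rank S))"
    using rank_le_card[OF assms] by (simp add: rank_point_def of_nat_diff)
  then show ?thesis
    by (simp add: weakly_above_iff)
qed

text \<open>The size of \<open>S\<close> is its nullity plus its rank, and the nullity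
  cancels.\<close>

lemma weakly_above_iff_path_level:
  assumes "finite S"
  shows "weakly_above s (rank_point S) \<longleftrightarrow> card S \<le> path_level s S"
  using rank_le_card[OF assms] by (auto simp: weakly_above_rank_point_iff[OF assms] path_level_def)

text \<open>The additive form avoids truncated subtraction and shows that a path forces
  \<open>0 < rank E < card E\<close>.\<close>

lemma mem_ferroni_paths_iff:
  "s \<in> ferroni_paths \<longleftrightarrow> set s \<subseteq> {(1, 1), (1, 0)} \<and> length s + rank E + 1 = card E \<and> ups s + 1 = rank E"
  unfolding ferroni_paths_def using sum_list_steps[of s] by auto

lemma ferroni_paths_eq_step_lists:
  assumes "0 < rank E" and "rank E < card E"
  shows "ferroni_paths = step_lists (card E - rank E - 1) (rank E - 1)"
  unfolding step_lists_def using assms by (auto simp: mem_ferroni_paths_iff)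

lemma finite_ferroni_paths: "finite ferroni_paths"
  by (rule finite_subset[OF _ finite_step_lists[of "card E - rank E - 1" "rank E - 1"]])
    (auto simp: step_lists_def mem_ferroni_paths_iff)

text \<open>For i = r the factor in the variables of \<open>B\<close> is 1, and the last factor has
  full degree on the complement, so it is up to sign the product of all its variables.\<close>

lemma sum_elem_sym_greedy_basis:
  fixes z :: "'a \<Rightarrow> 'c::comm_ring_1"
  assumes w: "w \<in> permutations_of_set E" and "E \<noteq> {}" and "\<nexists>e. loop e \<or> coloop e"
  defines "B \<equiv> greedy_basis w" and "r \<equiv> rank E" and "n \<equiv> card E"
  shows "(\<Sum>j<r. (- z (last w)) ^ j * elem_sym (r - j - 1) (E - B) z * elem_sym 0 B z * elem_sym (n - r) (E - B) (\<lambda>e. - z e))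
    = (-1) ^ (n - r) * (\<Sum>s\<in>ferroni_paths. flag_monom z (path_level s) {} w)"
proof -
  have r: "0 < r" "r < n"
    using rank_ground_bounds assms(2,3) by (auto simp: r_def n_def)
  have sw: "set w = E" and dw: "distinct w"
    using w by (auto simp: permutations_of_set_def)
  obtain u x where ux: "w = u @ [x]"
    using sw assms(2) by (cases w rule: rev_cases) auto
  have x: "x \<in> E" and su: "set u = E - {x}"
    using sw dw ux by auto
  \<comment> \<open>Since \<open>x\<close> is last and not a coloop, the elements before it already
    have full rank.\<close>
  have "x \<notin> B"
    unfolding B_def ux using mem_greedy_basis_iff[of u x "[]"] rank_diff_non_coloop[OF x] assms(3) dw x
    by (simp add: ux su insert_absorb)
  define cs where "cs = filter (\<lambda>c. c \<notin> B) u"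
  have filter_w: "filter (\<lambda>c. c \<notin> B) w = cs @ [x]"
    using \<open>x \<notin> B\<close> by (simp add: ux cs_def)
  have "length (cs @ [x]) = n - r"
    using length_filter_greedy_basis[of w "[]"] dw filter_w by (simp add: B_def sw r_def n_def)
  then have len: "length cs = n - r - 1"
    by simp
  have dcs: "distinct cs" and scs: "set cs = E - B - {x}"
    using dw su by (auto simp: cs_def ux)
  have "set (cs @ [x]) = E - B"
    using scs x \<open>x \<notin> B\<close> by auto
  then have card: "card (E - B) = n - r"
    using \<open>length (cs @ [x]) = n - r\<close> dcs scs distinct_card[of "cs @ [x]"] by simp
  have finB: "finite B"
    by (rule finite_subset[of _ "set w"]) (auto simp: B_def greedy_basis_def)
  \<comment> \<open>The path has one step for each entry of \<open>cs\<close> and none for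
    \<open>x\<close>, so \<open>x\<close> gets no second factor.\<close>
  have monom: "flag_monom z (path_level s) {} w = (\<Prod>c\<in>E - B. z c) * path_monom z cs s"
    if "s \<in> step_lists (n - r - 1) (r - 1)" for s
  proof -
    have "length s = length cs"
      using that len by (simp add: step_lists_def)
    then show ?thesis
      using flag_monom_path_level[of w "[]" z s] dw filter_w by (simp add: B_def sw path_monom_snoc)
  qed
  \<comment> \<open>Deleting \<open>x\<close> leaves n - r - 1 variables, listed by
    \<open>cs\<close> in the order of \<open>w\<close>.\<close>
  have "(\<Sum>j\<le>r - 1. (- z x) ^ j * elem_sym (r - 1 - j) (E - B) z) = elem_sym (r - 1) (set cs) z"
    unfolding scs using finite_ground x \<open>x \<notin> B\<close> by (intro elem_sym_remove) auto
  also have "\<dots> = (\<Sum>s\<in>step_lists (n - r - 1) (r - 1). path_monom z cs s)"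
    using elem_sym_conv_paths[OF dcs] len by simp
  finally have paths: "(\<Sum>j\<le>r - 1. (- z x) ^ j * elem_sym (r - 1 - j) (E - B) z) = \<dots>" .
  have top: "elem_sym (n - r) (E - B) (\<lambda>e. - z e) = (-1) ^ (n - r) * (\<Prod>c\<in>E - B. z c)"
    using elem_sym_card[of "E - B" "\<lambda>e. - z e"] finite_ground card by (simp add: prod_uminus)
  have "(\<Sum>j<r. (- z (last w)) ^ j * elem_sym (r - j - 1) (E - B) z * elem_sym 0 B z * elem_sym (n - r) (E - B) (\<lambda>e. - z e))
      = (\<Sum>j\<le>r - 1. (- z x) ^ j * elem_sym (r - 1 - j) (E - B) z) * elem_sym (n - r) (E - B) (\<lambda>e. - z e)"
    unfolding sum_distrib_right using r finB
    by (intro sum.cong) (auto simp: ux algebra_simps)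
  also have "\<dots> = (\<Sum>s\<in>step_lists (n - r - 1) (r - 1). path_monom z cs s) * ((-1) ^ (n - r) * (\<Prod>c\<in>E - B. z c))"
    by (simp only: paths top)
  also have "\<dots> = (-1) ^ (n - r) * (\<Sum>s\<in>step_lists (n - r - 1) (r - 1). flag_monom z (path_level s) {} w)"
    by (simp add: monom sum_distrib_left sum_distrib_right algebra_simps)
  also have "step_lists (n - r - 1) (r - 1) = ferroni_paths"
    unfolding r_def n_def by (rule ferroni_paths_eq_step_lists[OF r[unfolded r_def n_def], symmetric])
  finally show ?thesis .
qed

section \<open>The leading coefficient as a sum of order sums\<close>

lemma order_deg_sum: "(\<Sum>j\<in>J. order_deg (f j)) = order_deg (\<lambda>w. \<Sum>j\<in>J. f j w)"
  unfolding order_deg_def by (subst sum.swap) (simp add: Fract_conv_to_fract to_fract_sum sum_divide_distrib)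

lemma order_deg_flag_monom:
  "order_deg (\<lambda>w. flag_monom Var D {} w) = order_sum (\<lambda>e. to_fract (Var e)) D {} E"
  unfolding order_deg_def order_sum_def
proof (rule sum.cong)
  fix w assume "w \<in> permutations_of_set (E - {})"
  then have "length w = card E"
    by (simp add: length_finite_permutations_of_set)
  then have "(\<Prod>i<card E - 1. Var (w ! i) - Var (w ! Suc i)) = diff_prod Var w"
    by (simp add: diff_prod_conv_nth)
  then show "Fract (flag_monom Var D {} w) (\<Prod>i<card E - 1. Var (w ! i) - Var (w ! Suc i))
      = flag_monom (\<lambda>e. to_fract (Var e)) D {} w / diff_prod (\<lambda>e. to_fract (Var e)) w"
    by (simp add: Fract_conv_to_fract to_fract_flag_monom to_fract_diff_prod)
qed simp

lemma order_deg_cong: "(\<And>w. w \<in> permutations_of_set E \<Longrightarrow> f w = g w) \<Longrightarrow> order_deg f = order_deg g"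
  unfolding order_deg_def by simp

lemma order_deg_sign: "order_deg (\<lambda>w. (-1) ^ m * f w) = (-1) ^ m * order_deg f"
  unfolding order_deg_def by (simp add: Fract_conv_to_fract to_fract_power sum_distrib_left)

text \<open>Makes the exponent \<open>num_components - 1\<close> of \<open>omega_circ\<close> a
  genuine difference.\<close>

lemma num_components_pos:
  assumes "E \<noteq> {}"
  shows "0 < num_components"
proof -
  have "E // connected_rel \<noteq> {}"
    using assms by (simp add: quotient_def)
  moreover have "finite (E // connected_rel)"
    using finite_ground by (simp add: quotient_def)
  ultimately show ?thesis
    by (simp add: num_components_def card_gt_0_iff)
qed

lemma omega_circ_eq_sum_order_sum:
  assumes "E \<noteq> {}" and nolc: "\<nexists>e. loop e \<or> coloop e"
  shows "omega_circ = (-1) ^ (card E - 1) * (\<Sum>s\<in>ferroni_paths. order_sum (\<lambda>e. to_fract (Var e)) (path_level s) {} E)"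
proof -
  let ?r = "rank E" and ?n = "card E" and ?c = "num_components"
  have r: "0 < ?r" "?r < ?n"
    using rank_ground_bounds assms by auto
  define X where "X i = (\<Sum>j<i. order_deg (\<lambda>w. (- Var (last w)) ^ j * elem_sym (i - j - 1) (E - greedy_basis w) Var
      * elem_sym (?r - i) (greedy_basis w) Var * elem_sym (?n - ?r) (E - greedy_basis w) (\<lambda>e. - Var e)))" for i
  have "speyer_g = (-1) ^ ?c * (\<Sum>i = 1..?r. [:0, -1:] ^ i * [:X i:])"
    unfolding speyer_g_def X_def using assms by (simp add: Let_def)
  also have "\<dots> = smult ((-1) ^ ?c) (\<Sum>i = 1..?r. monom ((-1) ^ i * X i) i)"
  proof -
    have "[:0, -1:] ^ i * [:X i:] = monom ((-1) ^ i * X i) i" for i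
    proof -
      have "[:0, -1:] = monom (-1 :: 'a zpoly fract) 1" "[:X i:] = monom (X i) 0"
        by (simp_all add: monom_altdef)
      then show ?thesis
        by (simp add: monom_power mult_monom)
    qed
    moreover have "(-1) ^ ?c = [:(-1 :: 'a zpoly fract) ^ ?c:]"
      by (simp add: poly_const_pow[symmetric] one_pCons)
    ultimately show ?thesis
      by simp
  qed
  finally have "omega = (-1) ^ ?c * ((-1) ^ ?r * X ?r)"
    using r unfolding omega_def by (simp add: coeff_sum)
  moreover have "X ?r = order_deg (\<lambda>w. (-1) ^ (?n - ?r) * (\<Sum>s\<in>ferroni_paths. flag_monom Var (path_level s) {} w))"
    unfolding X_def order_deg_sum
    by (rule order_deg_cong) (use sum_elem_sym_greedy_basis[OF _ assms, of _ Var] in simp)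
  moreover have "\<dots> = (-1) ^ (?n - ?r) * (\<Sum>s\<in>ferroni_paths. order_sum (\<lambda>e. to_fract (Var e)) (path_level s) {} E)"
    by (simp add: order_deg_sign order_deg_sum[symmetric] order_deg_flag_monom)
  \<comment> \<open>The exponents add up to 2c - 1 + n, which has the parity of n - 1.\<close>
  moreover have "(-1) ^ (?c - 1) * ((-1) ^ ?c * ((-1) ^ ?r * (-1) ^ (?n - ?r))) = (-1 :: 'a zpoly fract) ^ (?n - 1)"
  proof -
    obtain c where "?c = Suc c"
      using num_components_pos[OF assms(1)] gr0_implies_Suc by blast
    moreover obtain m where "?n = Suc m"
      using r gr0_implies_Suc[of ?n] by auto
    moreover have "(-1) ^ ?r * (-1) ^ (?n - ?r) = (-1 :: 'a zpoly fract) ^ ?n"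
      using r by (simp flip: power_add)
    ultimately show ?thesis
      by (simp add: minus_one_power_iff)
  qed
  ultimately show ?thesis
    unfolding omega_circ_def by (metis (no_types, lifting) mult.assoc)
qed

lemma order_sum_path_level:
  assumes s: "s \<in> ferroni_paths"
  shows "order_sum (\<lambda>e. to_fract (Var e)) (path_level s) {} E
    = (-1) ^ (card E - 1) * of_int (chain_sum {S \<in> Pow E. weakly_above s (rank_point S)} {} E)"
proof -
  have len: "length s + rank E + 1 = card E" "ups s + 1 = rank E"
    using s by (auto simp: mem_ferroni_paths_iff)
  \<comment> \<open>The nullity n - r exceeds the length of \<open>s\<close>, so all r - 1 up steps
    count and the level is (n - r) + (r - 1).\<close>
  then have "path_level s E + 1 = card E"
    by (auto simp: path_level_def)
  moreover have "{} \<subset> E"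
    using len by auto
  moreover have "inj_on (\<lambda>e. to_fract (Var e)) (E - {})"
    by (simp add: inj_on_def Var_eq_iff)
  moreover have "{S \<in> Pow E. path_level s {} + card (S - {}) \<le> path_level s S} = {S \<in> Pow E. weakly_above s (rank_point S)}"
    using finite_ground by (auto simp: weakly_above_iff_path_level path_level_def ups_def dest: finite_subset)
  moreover have "path_level s {} = 0"
    by (simp add: path_level_def ups_def)
  ultimately show ?thesis
    using order_sum_eq_chain_sum[OF finite_ground _ _ mono_path_level, of "\<lambda>e. to_fract (Var e)" s] by simp
qed

section \<open>Chain sums with loops or coloops, and over flats\<close>

lemma rank_lt_of_weakly_above:
  assumes "s \<in> ferroni_paths" and "finite S" and "weakly_above s (rank_point S)"
  shows "rank S < rank E"
  using assms ups_take_le[of "card S - rank S" s]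
  by (auto simp: mem_ferroni_paths_iff weakly_above_rank_point_iff)

text \<open>Inserting a loop keeps the rank and does not lower the nullity, so it is a closure
  operator on the admissible sets; these stay proper, their rank being below that of
  \<open>E\<close>. Among the closed sets \<open>{e}\<close> is least.\<close>

lemma chain_sum_loop:
  assumes s: "s \<in> ferroni_paths" and e: "loop e"
  shows "chain_sum {S \<in> Pow E. weakly_above s (rank_point S)} {} E = 0"
proof -
  let ?Q = "{S \<in> Pow E. weakly_above s (rank_point S)}"
  have eE: "e \<in> E"
    using e by (simp add: loop_def)
  have fin: "finite S" if "S \<subseteq> E" for S
    using that finite_ground finite_subset by blast
  have mem: "S \<in> ?Q \<longleftrightarrow> S \<subseteq> E \<and> rank S \<le> ups (take (card S - rank S) s)" for S
    using weakly_above_rank_point_iff[of S s] fin[of S] by auto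
  have lt: "S \<noteq> E" if "S \<in> ?Q" for S
    using rank_lt_of_weakly_above[OF s, of S] that fin[of S] by auto
  have closed: "insert e S \<in> ?Q" if "S \<in> ?Q" for S
  proof -
    have "card S - rank S \<le> card (insert e S) - rank (insert e S)"
      using that fin[of S] by (intro nullity_mono) auto
    then show ?thesis
      using that eE rank_loop[OF e, of S] ups_take_mono[of _ "card (insert e S) - rank (insert e S)" s]
      unfolding mem by (metis insert_subset order.trans)
  qed
  have e1: "{e} \<in> ?Q"
    using rank_loop[OF e, of "{}"] eE unfolding mem by simp
  have "chain_sum ?Q {} E = chain_sum {S \<in> ?Q. insert e S = S} {} E"
  proof (rule chain_sum_closure)
    show "insert e S \<in> ?Q \<inter> {{}<..<E}" if "S \<in> ?Q \<inter> {{}<..<E}" for S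
    proof -
      have "insert e S \<in> ?Q"
        using that by (intro closed) blast
      moreover from this have "insert e S \<noteq> E" "insert e S \<subseteq> E"
        using lt by blast+
      ultimately show ?thesis
        by auto
    qed
  qed (use finite_ground in auto)
  also have "\<dots> = 0"
    using finite_ground e1 lt[OF e1] eE by (intro chain_sum_least_eq_0[where m = "{e}"]) auto
  finally show ?thesis .
qed

text \<open>Removing a coloop lowers the rank and keeps the nullity, so the point moves straight
  down and stays below the path. The set \<open>{e}\<close> has the point (0, 1) and is not
  admissible, as no step precedes abscissa 0.\<close>

lemma chain_sum_coloop:
  assumes s: "s \<in> ferroni_paths" and e: "coloop e"
  shows "chain_sum {S \<in> Pow E. weakly_above s (rank_point S)} {} E = 0"
proof (rule chain_sum_deletion_eq_0)
  let ?Q = "{S \<in> Pow E. weakly_above s (rank_point S)}"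
  have s': "length s + rank E + 1 = card E" "ups s + 1 = rank E"
    using s by (auto simp: mem_ferroni_paths_iff)
  show eE: "e \<in> E"
    using e by (simp add: coloop_def)
  have fin: "finite S" if "S \<subseteq> E" for S
    using that finite_ground finite_subset by blast
  have mem: "S \<in> ?Q \<longleftrightarrow> S \<subseteq> E \<and> rank S \<le> ups (take (card S - rank S) s)" for S
    using weakly_above_rank_point_iff[of S s] fin[of S] by auto
  show "finite ?Q"
    using finite_ground by simp
  have rank_e: "rank {e} = 1"
    using rank_coloop[OF e, of "{e}"] eE by simp
  then show "{e} \<notin> ?Q"
    unfolding mem by (simp add: ups_def)
  have del: "rank S = Suc (rank (S - {e}))" "card (S - {e}) - rank (S - {e}) = card S - rank S"
    if "S \<subseteq> E" "e \<in> S" for S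
  proof -
    show 1: "rank S = Suc (rank (S - {e}))"
      using rank_coloop[OF e] that by blast
    have "card S = Suc (card (S - {e}))"
      using that fin[of S] by (metis card_Suc_Diff1)
    then show "card (S - {e}) - rank (S - {e}) = card S - rank S"
      using 1 by simp
  qed
  show "S - {e} \<in> ?Q" if "S \<in> ?Q" "e \<in> S" for S
  proof -
    have S: "S \<subseteq> E" "rank S \<le> ups (take (card S - rank S) s)"
      using that(1) unfolding mem by blast+
    then show ?thesis
      unfolding mem using del[OF S(1) that(2)] by auto
  qed
  \<comment> \<open>Its point is (n - r, r - 1), past the last step, where all r - 1 up steps
    count.\<close>
  show "E - {e} \<in> ?Q"
    unfolding mem using del[OF _ eE] s' by auto
  show "E \<noteq> {e}"
    using rank_e s' by auto
qed

text \<open>With a loop or coloop \<open>speyer_g\<close> is 0, and so is the chain sum of each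
  path; otherwise two equal signs cancel.\<close>

lemma omega_circ_eq_sum_chain_sum:
  assumes "E \<noteq> {}"
  shows "omega_circ = of_int (\<Sum>s\<in>ferroni_paths. chain_sum {S \<in> Pow E. weakly_above s (rank_point S)} {} E)"
proof (cases "\<exists>e. loop e \<or> coloop e")
  case True
  then have "omega_circ = 0"
    using assms by (simp add: omega_circ_def omega_def speyer_g_def)
  moreover have "(\<Sum>s\<in>ferroni_paths. chain_sum {S \<in> Pow E. weakly_above s (rank_point S)} {} E) = 0"
    using True chain_sum_loop chain_sum_coloop by (intro sum.neutral) blast
  ultimately show ?thesis
    by simp
next
  case False
  have "(-1) ^ (card E - 1) * ((-1) ^ (card E - 1) * a) = a" for a :: "'a zpoly fract"
    by (simp add: mult.assoc[symmetric] flip: power_add)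
  then show ?thesis
    using omega_circ_eq_sum_order_sum[OF assms False]
    by (simp add: order_sum_path_level sum_distrib_left)
qed

text \<open>Closure keeps the rank and does not lower the nullity, so the point can only move to the
  right and stays below the path.\<close>

lemma chain_sum_flats:
  assumes s: "s \<in> ferroni_paths" and noloop: "\<nexists>e. loop e"
  shows "chain_sum {S \<in> Pow E. weakly_above s (rank_point S)} {} E = chain_sum {S \<in> flats. weakly_above s (rank_point S)} {} E"
proof -
  let ?Q = "{S \<in> Pow E. weakly_above s (rank_point S)}"
  have fin: "finite S" if "S \<subseteq> E" for S
    using that finite_ground finite_subset by blast
  have mem: "S \<in> ?Q \<longleftrightarrow> S \<subseteq> E \<and> rank S \<le> ups (take (card S - rank S) s)" for S
    using weakly_above_rank_point_iff[of S s] fin[of S] by auto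
  have "chain_sum ?Q {} E = chain_sum {S \<in> ?Q. closure S = S} {} E"
  proof (rule chain_sum_closure)
    show "finite ?Q"
      using finite_ground by simp
    fix S assume S: "S \<in> ?Q \<inter> {{}<..<E}"
    then have SE: "S \<subseteq> E" and rk: "rank S \<le> ups (take (card S - rank S) s)" and "S \<noteq> {}" and wa: "weakly_above s (rank_point S)"
      using mem[of S] by auto
    show sub: "S \<subseteq> closure S"
      by (rule subset_closure[OF SE])
    show "closure (closure S) = closure S"
      by (rule closure_closure[OF SE])
    have "card S - rank S \<le> card (closure S) - rank (closure S)"
      using sub fin[OF closure_subset] by (rule nullity_mono)
    then have "ups (take (card S - rank S) s) \<le> ups (take (card (closure S) - rank (closure S)) s)"
      by (rule ups_take_mono)
    then have "closure S \<in> ?Q"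
      using rk closure_subset rank_closure[OF SE] unfolding mem by simp
    \<comment> \<open>A path has only r - 1 up steps, so closing an admissible set never reaches
      \<open>E\<close>.\<close>
    moreover have "rank (closure S) < rank E"
      using rank_lt_of_weakly_above[OF s fin[OF SE] wa] rank_closure[OF SE] by simp
    then have "closure S \<noteq> E"
      by auto
    ultimately show "closure S \<in> ?Q \<inter> {{}<..<E}"
      using sub \<open>S \<noteq> {}\<close> closure_subset[of S] by auto
  next
    show "closure S \<subseteq> closure T" if "S \<subseteq> T" for S T
      using that by (rule closure_mono)
  qed
  also have "{S \<in> ?Q. closure S = S} = {S \<in> flats. weakly_above s (rank_point S)}"
    by (auto simp: flats_def)
  finally show ?thesis .
qed

end

theorem corollary9p5:
  fixes E :: "'a set" and indep :: "'a set \<Rightarrow> bool"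
  assumes "matroid E indep" and "E \<noteq> {}"
  shows "matroid.omega_circ E indep =
      of_int (\<Sum>C\<in>chains_between (Pow E) {} E.
        let k = length C - 1 in (-1) ^ (k - 1) *
          int (card {s \<in> matroid.ferroni_paths E indep.
            \<forall>i\<in>{1..<k}. weakly_above s (matroid.rank_point indep (C ! i))}))
    \<and> ((\<nexists>e. matroid.loop E indep e) \<longrightarrow>
      matroid.omega_circ E indep =
      of_int (\<Sum>C\<in>chains_between (matroid.flats E indep) (matroid.closure E indep {}) E.
        let k = length C - 1 in (-1) ^ (k - 1) *
          int (card {s \<in> matroid.ferroni_paths E indep.
            \<forall>i\<in>{1..<k}. weakly_above s (matroid.rank_point indep (C ! i))})))"
proof -
  interpret matroid E indep
    by (fact assms(1))
  have empty_E: "{} \<subset> E"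
    using assms(2) by blast
  have subsets: "omega_circ = of_int (\<Sum>C\<in>chains_between (Pow E) {} E.
        let k = length C - 1 in (-1) ^ (k - 1) *
          int (card {s \<in> ferroni_paths. \<forall>i\<in>{1..<k}. weakly_above s (rank_point (C ! i))}))"
    using finite_ground empty_E finite_ferroni_paths
    by (simp only: omega_circ_eq_sum_chain_sum[OF assms(2)] sum_chains_between finite_Pow_iff Pow_bottom Pow_top)
  have flats: "omega_circ = of_int (\<Sum>C\<in>chains_between flats (closure {}) E.
        let k = length C - 1 in (-1) ^ (k - 1) *
          int (card {s \<in> ferroni_paths. \<forall>i\<in>{1..<k}. weakly_above s (rank_point (C ! i))}))"
    if noloop: "\<nexists>e. loop e"
  proof -
    have "closure E = E"
      using subset_closure[of E] closure_subset[of E] by simp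
    \<comment> \<open>Without loops the minimum flat is empty, so chains of flats start where chains
      of subsets do.\<close>
    then have "{} \<in> flats" "E \<in> flats"
      using closure_empty[OF noloop] by (simp_all add: flats_def)
    moreover have "finite flats"
      by (rule finite_subset[of _ "Pow E"]) (use finite_ground in \<open>auto simp: flats_def\<close>)
    moreover have "omega_circ = of_int (\<Sum>s\<in>ferroni_paths. chain_sum {S \<in> flats. weakly_above s (rank_point S)} {} E)"
      using omega_circ_eq_sum_chain_sum[OF assms(2)] chain_sum_flats[OF _ noloop] by simp
    ultimately show ?thesis
      using empty_E finite_ferroni_paths by (simp only: closure_empty[OF noloop] sum_chains_between)
  qed
  show ?thesis
    using subsets flats by blast
qed

end
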